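(* Let $N=3$, let $\Omega\subset\mathbb{R}^3$ be a bounded, connected open set with Lipschitz boundary, let $\mathcal{L}$ be an equilibrated load functional, and let $\mathcal{V}_0$ be any measurable family of uniformly positive definite quadratic forms (as specified in the context). Then the functional $\mathcal{F}:H^1(\Omega;\mathbb{R}^3)\to\mathbb{R}$, $$\mathcal{F}(\mathbf{v})=\min_{\mathbf{W}\in\mathcal{M}^{3\times 3}_{skew}}\int_\Omega \mathcal{V}_0\Big(\mathbf{x},\,\mathbb{E}(\mathbf{v})-\tfrac12\mathbf{W}^2\Big)\,d\mathbf{x}\;-\;\mathcal{L}(\mathbf{v}),$$ is not convex.
   Context: $\mathcal{M}^{N\times N}$, $\mathcal{M}^{N\times N}_{sym}$, $\mathcal{M}^{N\times N}_{skew}$ denote the real, real symmetric and real skew-symmetric $N\times N$ matrices; $|\mathbf{B}|^2=\mathrm{Tr}(\mathbf{B}^T\mathbf{B})$. For $\mathbf{v}\in H^1(\Omega;\mathbb{R}^N)$, $\mathbb{E}(\mathbf{v})=\frac12(\nabla\mathbf{v}^T+\nabla\mathbf{v})$. Quadratic forms: for a.e. $\mathbf{x}\in\Omega$, $\mathcal{V}_0(\mathbf{x},\cdot)$ is a quadratic form on matrices, depending measurably on $\mathbf{x}$, and there are constants $0<\alpha\le\gamma$ independent of $\mathbf{x}$ with $\alpha|\mathbf{B}|^2\le\mathcal{V}_0(\mathbf{x},\mathbf{B})\le\gamma|\mathbf{B}|^2$ for all $\mathbf{B}\in\mathcal{M}^{N\times N}_{sym}$. (Only symmetric arguments occur in $\mathcal{F}$.)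 Load: $\mathcal{L}(\mathbf{v})=\int_{\partial\Omega}\mathbf{f}\cdot\mathbf{v}\,d\mathcal{H}^{N-1}+\int_\Omega\mathbf{g}\cdot\mathbf{v}\,d\mathbf{x}$ with $\mathbf{f}\in L^2(\partial\Omega;\mathbb{R}^N)$, $\mathbf{g}\in L^2(\Omega;\mathbb{R}^N)$. The load is equilibrated: $\mathcal{L}(\mathbf{z})=0$ for every $\mathbf{z}$ with $\mathbb{E}(\mathbf{z})\equiv\mathbf{0}$. The minimum over $\mathbf{W}$ defining $\mathcal{F}(\mathbf{v})$ is attained for every $\mathbf{v}\in H^1(\Omega;\mathbb{R}^N)$. *)

theory Defs
  imports "HOL-Analysis.Analysis"
begin

section \<open>Domains with Lipschitz boundary\<close>

text \<open>
  Coordinates near a boundary point are given by a unit vector \<open>e\<close>: \<open>y \<bullet> e\<close> is the last coordinate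
  and \<open>y - (y \<bullet> e) *\<^sub>R e\<close>, a point of the hyperplane orthogonal to \<open>e\<close>, stands for the others.
\<close>

definition lipschitz_boundary :: "(real^'n) set \<Rightarrow> bool" where
  "lipschitz_boundary \<Omega> \<longleftrightarrow>
     (\<forall>x\<in>frontier \<Omega>. \<exists>r>0. \<exists>e h L. norm e = 1 \<and> L-lipschitz_on {y. y \<bullet> e = 0} h \<and>
        \<Omega> \<inter> ball x r = {y \<in> ball x r. h (y - (y \<bullet> e) *\<^sub>R e) < y \<bullet> e})"

section \<open>Hausdorff measure\<close>

text \<open>Covers by possibly empty sets are allowed, so that finite covers are included; the case
  distinction only matters for \<open>d = 0\<close>, since \<open>0 ^ 0 = 1\<close>. The bound on \<open>C i\<close> is needed
  because \<^const>\<open>diameter\<close> is unspecific on unbounded sets.\<close>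

definition hausdorff_pre :: "nat \<Rightarrow> real \<Rightarrow> 'a::metric_space set \<Rightarrow> ennreal" where
  "hausdorff_pre d \<delta> A =
     (INF C\<in>{C :: nat \<Rightarrow> 'a set. A \<subseteq> (\<Union>i. C i) \<and> (\<forall>i. bounded (C i) \<and> diameter (C i) \<le> \<delta>)}.
        \<Sum>i. if C i = {} then 0 else ennreal (unit_ball_vol (real d) * (diameter (C i) / 2) ^ d))"

definition hausdorff_outer :: "nat \<Rightarrow> 'a::metric_space set \<Rightarrow> ennreal" where
  "hausdorff_outer d A = (SUP \<delta>\<in>{0<..}. hausdorff_pre d \<delta> A)"

definition hausdorff_measure :: "nat \<Rightarrow> 'a::metric_space measure" where
  "hausdorff_measure d = measure_of UNIV (sets borel) (hausdorff_outer d)"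

definition boundary_measure :: "(real^'n) set \<Rightarrow> (real^'n) measure" where
  "boundary_measure \<Omega> = restrict_space (hausdorff_measure (CARD('n) - 1)) (frontier \<Omega>)"

section \<open>Sobolev functions\<close>

definition square_integrable ::
    "'a measure \<Rightarrow> ('a \<Rightarrow> 'b::{second_countable_topology, banach}) \<Rightarrow> bool" where
  "square_integrable M f \<longleftrightarrow> f \<in> borel_measurable M \<and> integrable M (\<lambda>x. (norm (f x))\<^sup>2)"

definition partial_deriv :: "'n \<Rightarrow> (real^'n \<Rightarrow> real) \<Rightarrow> real^'n \<Rightarrow> real" where
  "partial_deriv j \<phi> x = frechet_derivative \<phi> (at x) (axis j 1)"

primrec C_k :: "nat \<Rightarrow> (real^'n \<Rightarrow> real) \<Rightarrow> bool" where
  "C_k 0 \<phi> \<longleftrightarrow> continuous_on UNIV \<phi>"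
| "C_k (Suc k) \<phi> \<longleftrightarrow> (\<forall>x. \<phi> differentiable (at x)) \<and> (\<forall>j. C_k k (partial_deriv j \<phi>))"

definition test_functions :: "(real^'n) set \<Rightarrow> (real^'n \<Rightarrow> real) set" where
  "test_functions \<Omega> =
     {\<phi>. (\<forall>k. C_k k \<phi>) \<and> compact (closure {x. \<phi> x \<noteq> 0}) \<and> closure {x. \<phi> x \<noteq> 0} \<subseteq> \<Omega>}"

text \<open>The entry \<open>G x $ i $ j\<close> is the weak derivative of the \<open>i\<close>-th component in direction \<open>j\<close>.\<close>

definition is_weak_gradient ::
    "(real^'n) set \<Rightarrow> (real^'n \<Rightarrow> real^'n) \<Rightarrow> (real^'n \<Rightarrow> real^'n^'n) \<Rightarrow> bool" where
  "is_weak_gradient \<Omega> v G \<longleftrightarrow> square_integrable (lebesgue_on \<Omega>) G \<and>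
     (\<forall>\<phi>\<in>test_functions \<Omega>. \<forall>i j.
        (LINT x|lebesgue_on \<Omega>. v x $ i * partial_deriv j \<phi> x)
        = - (LINT x|lebesgue_on \<Omega>. G x $ i $ j * \<phi> x))"

text \<open>Elements of \<open>H\<^sup>1\<close> are represented by functions on the whole space of which only the values
  almost everywhere in \<open>\<Omega>\<close> matter; all notions below are invariant under changes on null sets
  and outside \<open>\<Omega>\<close>.\<close>

definition H1 :: "(real^'n) set \<Rightarrow> (real^'n \<Rightarrow> real^'n) set" where
  "H1 \<Omega> = {v. square_integrable (lebesgue_on \<Omega>) v \<and> (\<exists>G. is_weak_gradient \<Omega> v G)}"

definition weak_gradient :: "(real^'n) set \<Rightarrow> (real^'n \<Rightarrow> real^'n) \<Rightarrow> real^'n \<Rightarrow> real^'n^'n" where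
  "weak_gradient \<Omega> v = (SOME G. is_weak_gradient \<Omega> v G)"

definition strain :: "(real^'n) set \<Rightarrow> (real^'n \<Rightarrow> real^'n) \<Rightarrow> real^'n \<Rightarrow> real^'n^'n" where
  "strain \<Omega> v x = (1/2) *\<^sub>R (transpose (weak_gradient \<Omega> v x) + weak_gradient \<Omega> v x)"

text \<open>The boundary trace at \<open>x\<close> is the value \<open>z\<close> for which the means of \<open>|v - z|\<close> over
  \<open>\<Omega> \<inter> ball x r\<close> tend to \<open>0\<close> as \<open>r\<close> tends to \<open>0\<close>. For a bounded Lipschitz domain \<open>\<Omega>\<close> and
  \<open>v \<in> H1 \<Omega>\<close> such a value exists at almost every boundary point with respect to the surface
  measure, and this is the usual trace of \<open>v\<close> (Evans and Gariepy, Measure Theory and Fine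
  Properties of Functions, Section 5.3; Ambrosio, Fusco and Pallara, Functions of Bounded
  Variation and Free Discontinuity Problems, Theorem 3.87).\<close>

definition boundary_trace :: "(real^'n) set \<Rightarrow> (real^'n \<Rightarrow> real^'n) \<Rightarrow> real^'n \<Rightarrow> real^'n" where
  "boundary_trace \<Omega> v x =
     (THE z. ((\<lambda>r. (LINT y|lebesgue_on (\<Omega> \<inter> ball x r). norm (v y - z))
                    / measure lebesgue (\<Omega> \<inter> ball x r)) \<longlongrightarrow> 0) (at_right 0))"

section \<open>The energy functional\<close>

definition load ::
    "(real^'n) set \<Rightarrow> (real^'n \<Rightarrow> real^'n) \<Rightarrow> (real^'n \<Rightarrow> real^'n) \<Rightarrow> (real^'n \<Rightarrow> real^'n) \<Rightarrow> real"
where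
  "load \<Omega> f g v = (LINT x|boundary_measure \<Omega>. f x \<bullet> boundary_trace \<Omega> v x)
                 + (LINT x|lebesgue_on \<Omega>. g x \<bullet> v x)"

definition equilibrated ::
    "(real^'n) set \<Rightarrow> (real^'n \<Rightarrow> real^'n) \<Rightarrow> (real^'n \<Rightarrow> real^'n) \<Rightarrow> bool" where
  "equilibrated \<Omega> f g \<longleftrightarrow>
     (\<forall>z\<in>H1 \<Omega>. (AE x in lebesgue_on \<Omega>. strain \<Omega> z x = 0) \<longrightarrow> load \<Omega> f g z = 0)"

definition quadratic_form :: "('a::real_vector \<Rightarrow> real) \<Rightarrow> bool" where
  "quadratic_form Q \<longleftrightarrow> (\<exists>b. bilinear b \<and> (\<forall>x. Q x = b x x))"

definition sym_matrices :: "(real^'n^'n) set" where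
  "sym_matrices = {B. transpose B = B}"

definition skew_matrices :: "(real^'n^'n) set" where
  "skew_matrices = {W. transpose W = - W}"

text \<open>For the forms considered here the minimum over skew-symmetric \<open>W\<close> is attained at every
  \<open>v \<in> H1 \<Omega>\<close>, so it equals the infimum.\<close>

definition energy ::
    "(real^'n) set \<Rightarrow> (real^'n \<Rightarrow> real^'n^'n \<Rightarrow> real) \<Rightarrow> (real^'n \<Rightarrow> real^'n) \<Rightarrow> (real^'n \<Rightarrow> real^'n)
      \<Rightarrow> (real^'n \<Rightarrow> real^'n) \<Rightarrow> real"
where
  "energy \<Omega> V\<^sub>0 f g v =
     (INF W\<in>skew_matrices. LINT x|lebesgue_on \<Omega>. V\<^sub>0 x (strain \<Omega> v x - (1/2) *\<^sub>R (W ** W)))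
     - load \<Omega> f g v"

text \<open>Convexity is spelled out because \<^const>\<open>convex_on\<close> requires a type of class
  \<^class>\<open>real_vector\<close>, of which the function space is not an instance.\<close>

definition convex_functional :: "('a \<Rightarrow> 'b::real_vector) set \<Rightarrow> (('a \<Rightarrow> 'b) \<Rightarrow> real) \<Rightarrow> bool" where
  "convex_functional S F \<longleftrightarrow>
     (\<forall>u\<in>S. \<forall>v\<in>S. \<forall>t\<in>{0..1}.
        F (\<lambda>x. (1 - t) *\<^sub>R u x + t *\<^sub>R v x) \<le> (1 - t) * F u + t * F v)"

end

theory Submission
  imports Defs
begin

text \<open>
  For skew-symmetric \<open>W\<close> with axial vector \<open>(a, b, 0)\<close>, the linear field with gradient \<open>W\<^sup>2/2\<close> makes
  the minimum over \<open>W\<close> vanish. A proper convex combination of two such gradients with non-parallel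
  axial vectors is no longer of the form \<open>W\<^sup>2/2\<close>, because \<open>(tr M / 2) I - M\<close> has rank at most one for
  \<open>M = - W\<^sup>2\<close>. It has positive distance to all \<open>W\<^sup>2/2\<close>, so by coercivity the minimum is positive there.
  If the load is affine along the segment, this contradicts convexity.

  Integrability of \<open>f\<close> times a linear field over the boundary would follow from finiteness of the surface
  measure. This is avoided: among three axial vectors two give boundary integrands that are both integrable
  or both non-integrable, and in either case some point of the segment has the affine load value.
\<close>

section \<open>Smooth bump functions\<close>

primrec cont_diff :: "nat \<Rightarrow> (real \<Rightarrow> real) \<Rightarrow> bool" where
  "cont_diff 0 f \<longleftrightarrow> continuous_on UNIV f"
| "cont_diff (Suc k) f \<longleftrightarrow>
     (\<forall>x. (f has_real_derivative deriv f x) (at x)) \<and> cont_diff k (deriv f)"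

lemma cont_diff_SucI:
  assumes "\<And>x. (f has_real_derivative f' x) (at x)" "cont_diff k f'"
  shows "cont_diff (Suc k) f"
proof -
  have "deriv f = f'"
    using DERIV_imp_deriv[OF assms(1)] by (rule ext)
  with assms show ?thesis
    by simp
qed

lemma cont_diff_DERIV: "cont_diff (Suc k) f \<Longrightarrow> (f has_real_derivative deriv f x) (at x)"
  by simp

lemma cont_diff_deriv: "cont_diff (Suc k) f \<Longrightarrow> cont_diff k (deriv f)"
  by simp

lemma DERIV_imp_continuous_on_UNIV:
  "(\<And>x. (f has_real_derivative f' x) (at x)) \<Longrightarrow> continuous_on UNIV f"
  by (meson DERIV_continuous_on has_field_derivative_at_within)

text \<open>The product rule below leaves one factor undifferentiated; this lowers the order of that
  factor.\<close>

lemma cont_diff_SucD: "cont_diff (Suc k) f \<Longrightarrow> cont_diff k f"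
proof (induction k arbitrary: f)
  case 0
  from DERIV_imp_continuous_on_UNIV[OF cont_diff_DERIV[OF 0]] show ?case
    by simp
next
  case (Suc k)
  show ?case
    by (rule cont_diff_SucI[OF cont_diff_DERIV[OF Suc.prems] Suc.IH[OF cont_diff_deriv[OF Suc.prems]]])
qed

lemma cont_diff_const: "cont_diff k (\<lambda>x. c)"
proof (induction k arbitrary: c)
  case (Suc k)
  show ?case
    by (rule cont_diff_SucI[OF DERIV_const Suc])
qed simp

lemma cont_diff_add: "cont_diff k f \<Longrightarrow> cont_diff k g \<Longrightarrow> cont_diff k (\<lambda>x. f x + g x)"
proof (induction k arbitrary: f g)
  case (Suc k)
  show ?case
    by (rule cont_diff_SucI[OF DERIV_add[OF Suc.prems[THEN cont_diff_DERIV]]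
          Suc.IH[OF Suc.prems[THEN cont_diff_deriv]]])
qed (simp add: continuous_on_add)

lemma cont_diff_mult: "cont_diff k f \<Longrightarrow> cont_diff k g \<Longrightarrow> cont_diff k (\<lambda>x. f x * g x)"
proof (induction k arbitrary: f g)
  case (Suc k)
  have "cont_diff k (\<lambda>x. deriv f x * g x + deriv g x * f x)"
    by (intro cont_diff_add Suc.IH Suc.prems[THEN cont_diff_deriv] Suc.prems[THEN cont_diff_SucD])
  then show ?case
    by (rule cont_diff_SucI[OF DERIV_mult[OF Suc.prems[THEN cont_diff_DERIV]]])
qed (simp add: continuous_on_mult)

lemma cont_diff_compose_affine: "cont_diff k f \<Longrightarrow> cont_diff k (\<lambda>x. f (c * x + d))"
proof (induction k arbitrary: f)
  case 0
  then have "continuous_on UNIV f"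
    by simp
  moreover have "continuous_on UNIV (\<lambda>x. c * x + d)"
    by (intro continuous_intros)
  ultimately have "continuous_on UNIV (\<lambda>x. f (c * x + d))"
    by (rule continuous_on_compose2) simp
  then show ?case
    by simp
next
  case (Suc k)
  have "((\<lambda>x. c * x + d) has_real_derivative c) (at x)" for x
    by (auto intro!: derivative_eq_intros)
  from DERIV_chain2[OF cont_diff_DERIV[OF Suc.prems] this]
  have "((\<lambda>x. f (c * x + d)) has_real_derivative deriv f (c * x + d) * c) (at x)" for x .
  moreover have "cont_diff k (\<lambda>x. deriv f (c * x + d) * c)"
    by (rule cont_diff_mult[OF Suc.IH[OF cont_diff_deriv[OF Suc.prems]] cont_diff_const])
  ultimately show ?case
    by (rule cont_diff_SucI)
qed

text \<open>Differentiating \<open>exp (- (1 / x))\<close> repeatedly produces its products with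
  powers of \<open>1 / x\<close>. With the exponent \<open>m\<close> as a parameter the family is
  closed under differentiation up to linear combinations, so smoothness takes a single
  induction.\<close>

definition flat_exp :: "nat \<Rightarrow> real \<Rightarrow> real" where
  "flat_exp m x = (if x > 0 then (1 / x) ^ m * exp (- (1 / x)) else 0)"

text \<open>With \<open>y = 1 / x\<close> the limit from the right is that of
  \<open>y ^ m / exp y\<close> at infinity; on the left the function is zero.\<close>

lemma flat_exp_tendsto_0: "(flat_exp m \<longlongrightarrow> 0) (at 0)"
proof -
  have "((\<lambda>x. inverse x ^ m / exp (inverse x)) \<longlongrightarrow> (0::real)) (at_right 0)"
    by (rule filterlim_compose[OF tendsto_power_div_exp_0 filterlim_inverse_at_top_right])
  then have "(flat_exp m \<longlongrightarrow> 0) (at_right 0)"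
    by (rule Lim_transform_eventually)
      (auto simp: flat_exp_def eventually_at_filter exp_minus divide_simps)
  moreover have "(flat_exp m \<longlongrightarrow> 0) (at_left 0)"
    by (rule tendsto_eventually) (auto simp: flat_exp_def eventually_at_filter)
  ultimately show ?thesis by (simp add: filterlim_split_at)
qed

lemma flat_exp_has_derivative:
  "(flat_exp m has_real_derivative flat_exp (m + 2) x + - real m * flat_exp (m + 1) x) (at x)"
proof (cases x "0::real" rule: linorder_cases)
  case less
  have "((\<lambda>_. 0) has_real_derivative flat_exp (m + 2) x + - real m * flat_exp (m + 1) x) (at x)"
    using less by (simp add: flat_exp_def)
  then show ?thesis
    by (rule has_field_derivative_transform_within_open[of _ _ _ "{..<0}"])
      (use less in \<open>auto simp: flat_exp_def\<close>)
next
  case equal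
  \<comment> \<open>The difference quotient of \<open>flat_exp m\<close> at 0 is
    \<open>flat_exp (Suc m)\<close>, so the preceding limit gives derivative 0.\<close>
  have "((\<lambda>h. flat_exp m h / h) \<longlongrightarrow> 0) (at 0)"
    by (rule Lim_transform_eventually[OF flat_exp_tendsto_0[of "Suc m"]])
      (auto simp: flat_exp_def eventually_at_filter)
  then show ?thesis
    using equal by (simp add: DERIV_def flat_exp_def)
next
  case greater
  have "((\<lambda>x. (1 / x) ^ m * exp (- (1 / x))) has_real_derivative
      flat_exp (m + 2) x + - real m * flat_exp (m + 1) x) (at x)"
  proof -
    have 1: "((\<lambda>x. exp (- (1 / x))) has_real_derivative (1 / x)\<^sup>2 * exp (- (1 / x))) (at x)"
      using greater by (auto intro!: derivative_eq_intros simp: field_simps power2_eq_square)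
    have 2: "((\<lambda>x. (1 / x) ^ m) has_real_derivative - real m * (1 / x) ^ (m + 1)) (at x)"
    proof (cases m)
      case (Suc k)
      have "((\<lambda>x. 1 / x) has_real_derivative - (1 / x)\<^sup>2) (at x)"
        using greater by (auto intro!: derivative_eq_intros simp: field_simps power2_eq_square)
      moreover have "(1 + real k) * (- y\<^sup>2 * y ^ k) = - real (Suc k) * y ^ (Suc k + 1)" for y :: real
        by (simp add: algebra_simps power2_eq_square)
      ultimately show ?thesis
        unfolding Suc by (intro DERIV_cong[OF DERIV_power_Suc])
    qed simp
    show ?thesis
      by (rule DERIV_cong[OF DERIV_mult[OF 2 1]])
        (use greater in \<open>simp add: flat_exp_def algebra_simps power_add power2_eq_square\<close>)
  qed
  then show ?thesis
    by (rule has_field_derivative_transform_within_open[of _ _ _ "{0<..}"])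
      (use greater in \<open>auto simp: flat_exp_def\<close>)
qed

lemma cont_diff_flat_exp: "cont_diff k (flat_exp m)"
proof (induction k arbitrary: m)
  case 0
  then show ?case
    using DERIV_imp_continuous_on_UNIV[OF flat_exp_has_derivative[of m]] by simp
next
  case (Suc k)
  then have "cont_diff k (\<lambda>x. flat_exp (m + 2) x + - real m * flat_exp (m + 1) x)"
    by (intro cont_diff_add cont_diff_mult cont_diff_const)
  then show ?case
    by (rule cont_diff_SucI[OF flat_exp_has_derivative])
qed

section \<open>Smooth functions of several variables as products over the coordinates\<close>

lemma prod_nth_has_derivative:
  fixes x :: "real^'n"
  assumes "\<And>i. (f i has_real_derivative f' i) (at (x $ i))"
  shows "((\<lambda>x. \<Prod>i\<in>UNIV. f i (x $ i)) has_derivative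
    (\<lambda>y. \<Sum>i\<in>UNIV. (f' i * y $ i) * (\<Prod>j\<in>UNIV - {i}. f j (x $ j)))) (at x)"
proof (rule has_derivative_prod)
  fix i
  have "(f i has_derivative (\<lambda>h. f' i * h)) (at (x $ i))"
    using assms[of i] by (simp add: has_field_derivative_def)
  from has_derivative_compose[OF
      bounded_linear.has_derivative[OF bounded_linear_vec_nth has_derivative_ident] this]
  show "((\<lambda>x. f i (x $ i)) has_derivative (\<lambda>y. f' i * y $ i)) (at x)" .
qed

lemma partial_deriv_prod_nth:
  fixes x :: "real^'n"
  assumes "\<And>i. (f i has_real_derivative f' i) (at (x $ i))"
  shows "partial_deriv j (\<lambda>x. \<Prod>i\<in>UNIV. f i (x $ i)) x = f' j * (\<Prod>i\<in>UNIV - {j}. f i (x $ i))"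
proof -
  have "frechet_derivative (\<lambda>x. \<Prod>i\<in>UNIV. f i (x $ i)) (at x) =
    (\<lambda>y. \<Sum>i\<in>UNIV. (f' i * y $ i) * (\<Prod>j\<in>UNIV - {i}. f j (x $ j)))"
    by (rule frechet_derivative_at[symmetric, OF prod_nth_has_derivative[of f f' x, OF assms]])
  then show ?thesis
    by (simp add: partial_deriv_def axis_def if_distrib if_distribR cong: if_cong)
qed

text \<open>A partial derivative of such a product has the same form: only the factor of that
  coordinate is replaced by its derivative. Hence the induction ranges over all families
  \<open>f\<close>.\<close>

lemma C_k_prod_nth:
  fixes f :: "'n::finite \<Rightarrow> real \<Rightarrow> real"
  assumes "\<And>i. cont_diff k (f i)"
  shows "C_k k (\<lambda>x :: real^'n. \<Prod>i\<in>UNIV. f i (x $ i))"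
  using assms
proof (induction k arbitrary: f)
  case 0
  have "continuous_on UNIV (\<lambda>x :: real^'n. f i (x $ i))" for i
  proof -
    have "continuous_on UNIV (f i)" "continuous_on UNIV (\<lambda>x :: real^'n. x $ i)"
      using 0[of i] by (simp_all add: continuous_on_component)
    then show ?thesis
      by (rule continuous_on_compose2) simp
  qed
  then show ?case
    by (simp add: continuous_on_prod)
next
  case (Suc k)
  have der: "(f i has_real_derivative deriv (f i) (x $ i)) (at (x $ i))" for i and x :: "real^'n"
    by (rule cont_diff_DERIV[OF Suc.prems])
  have "C_k k (partial_deriv j (\<lambda>x :: real^'n. \<Prod>i\<in>UNIV. f i (x $ i)))" for j
  proof -
    define h where "h i = (if i = j then deriv (f j) else f i)" for i
    have "partial_deriv j (\<lambda>x. \<Prod>i\<in>UNIV. f i (x $ i)) x = (\<Prod>i\<in>UNIV. h i (x $ i))"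
      for x :: "real^'n"
    proof -
      have "(\<Prod>i\<in>UNIV. h i (x $ i)) = h j (x $ j) * (\<Prod>i\<in>UNIV - {j}. h i (x $ i))"
        by (rule prod.remove) simp_all
      also have "(\<Prod>i\<in>UNIV - {j}. h i (x $ i)) = (\<Prod>i\<in>UNIV - {j}. f i (x $ i))"
        by (rule prod.cong) (simp_all add: h_def)
      finally show ?thesis
        unfolding partial_deriv_prod_nth[of f "\<lambda>i. deriv (f i) (x $ i)" x j, OF der]
        by (simp add: h_def)
    qed
    moreover have "cont_diff k (h i)" for i
      using cont_diff_deriv[OF Suc.prems] cont_diff_SucD[OF Suc.prems] by (simp add: h_def)
    ultimately show ?thesis
      using Suc.IH[of h] by presburger
  qed
  moreover have "(\<lambda>x. \<Prod>i\<in>UNIV. f i (x $ i)) differentiable (at x)" for x :: "real^'n"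
    by (rule differentiableI[OF prod_nth_has_derivative[of f "\<lambda>i. deriv (f i) (x $ i)" x, OF der]])
  ultimately show ?case
    by simp
qed

text \<open>Smooth on the whole space and nonzero exactly on the open box. As \<open>n\<close>
  grows, the factor \<open>Suc n\<close> pushes each value inside the box to 1, so the bumps
  approximate the indicator of the box while staying between 0 and 1.\<close>

definition bump :: "real^'n \<Rightarrow> real^'n \<Rightarrow> nat \<Rightarrow> real^'n \<Rightarrow> real" where
  "bump a b n x = (\<Prod>i\<in>UNIV. flat_exp 0 (real (Suc n) * (x $ i - a $ i)) *
     flat_exp 0 (real (Suc n) * (b $ i - x $ i)))"

lemma flat_exp_0_bounds: "0 \<le> flat_exp 0 x" "flat_exp 0 x \<le> 1"
  by (auto simp: flat_exp_def)

lemma bump_bounds: "0 \<le> bump a b n x" "bump a b n x \<le> 1"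
  unfolding bump_def by (auto intro!: prod_nonneg prod_le_1 mult_le_one simp: flat_exp_0_bounds)

lemma bump_nonzero_iff: "bump a b n x \<noteq> 0 \<longleftrightarrow> x \<in> box a b"
  by (auto simp: bump_def flat_exp_def mem_box_cart zero_less_mult_iff)

lemma bump_tendsto: "(\<lambda>n. bump a b n x) \<longlonglongrightarrow> indicator (box a b) x"
proof (cases "x \<in> box a b")
  case True
  have *: "(\<lambda>n. flat_exp 0 (real (Suc n) * c)) \<longlonglongrightarrow> 1" if "c > 0" for c
  proof -
    have "(\<lambda>n. exp (- (inverse (real (Suc n)) * inverse c))) \<longlonglongrightarrow> exp (- (0 * inverse c))"
      by (intro tendsto_intros LIMSEQ_inverse_real_of_nat)
    moreover have "flat_exp 0 (real (Suc n) * c) = exp (- (inverse (real (Suc n)) * inverse c))" for n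
      using that by (simp add: flat_exp_def inverse_eq_divide del: of_nat_Suc)
    ultimately show ?thesis
      by simp
  qed
  have "(\<lambda>n. bump a b n x) \<longlonglongrightarrow> (\<Prod>i\<in>(UNIV :: 'a set). 1 * 1)"
    unfolding bump_def using True
    by (intro tendsto_prod tendsto_mult *) (auto simp: mem_box_cart)
  then show ?thesis using True by simp
next
  case False
  then have "bump a b n x = 0" for n
    using bump_nonzero_iff by blast
  then show ?thesis using False by simp
qed

lemma bump_test_function:
  assumes "cbox a b \<subseteq> \<Omega>"
  shows "bump a b n \<in> test_functions \<Omega>"
proof -
  \<comment> \<open>The arguments of both factors are written as \<open>c * t + d\<close> so that
    the lemma on affine substitution applies.\<close>
  have "cont_diff k (\<lambda>t. flat_exp 0 (real (Suc n) * t + - (real (Suc n) * a $ i)) *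
     flat_exp 0 (- real (Suc n) * t + (real (Suc n) * b $ i)))" for k i
    by (rule cont_diff_mult[OF cont_diff_compose_affine[OF cont_diff_flat_exp]
          cont_diff_compose_affine[OF cont_diff_flat_exp]])
  from C_k_prod_nth[OF this] have "C_k k (bump a b n)" for k
    unfolding bump_def right_diff_distrib
    by (simp only: minus_mult_left[symmetric] add_uminus_conv_diff minus_diff_commute
        add.commute[of "- (_ :: real)"])
  moreover have "closure {x. bump a b n x \<noteq> 0} \<subseteq> cbox a b"
    unfolding bump_nonzero_iff by (simp add: box_subset_cbox closure_minimal closed_cbox)
  ultimately show ?thesis
    using assms bounded_subset[OF bounded_cbox] unfolding test_functions_def
    by (simp add: compact_eq_bounded_closed) blast
qed

section \<open>Weak gradients and boundary traces of linear fields\<close>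

lemma integral_box_eq_0:
  fixes h :: "real^'n \<Rightarrow> real"
  assumes "open \<Omega>" and h: "integrable (lebesgue_on \<Omega>) h"
    and zero: "\<And>\<phi>. \<phi> \<in> test_functions \<Omega> \<Longrightarrow> (LINT x|lebesgue_on \<Omega>. h x * \<phi> x) = 0"
    and "cbox a b \<subseteq> \<Omega>"
  shows "integral (cbox a b) (\<lambda>x. if x \<in> \<Omega> then h x else 0) = 0"
proof -
  have [simp]: "\<Omega> \<in> sets lebesgue"
    using \<open>open \<Omega>\<close> by simp
  let ?H = "\<lambda>x. if x \<in> \<Omega> then h x else 0"
  have bump_meas: "bump a b n \<in> borel_measurable (lebesgue_on \<Omega>)" for n
  proof -
    have "C_k 0 (bump a b n)"
      using bump_test_function[OF assms(4)] by (simp add: test_functions_def del: C_k.simps)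
    then have "bump a b n \<in> borel_measurable borel"
      by (simp add: borel_measurable_continuous_onI)
    then show ?thesis
      by (intro measurable_restrict_space1 measurable_completion) simp
  qed
  \<comment> \<open>The bumps serve as test functions. They converge to the indicator of the box and
    are bounded by 1, so \<open>norm (h x)\<close> dominates.\<close>
  have "(\<lambda>n. LINT x|lebesgue_on \<Omega>. h x * bump a b n x) \<longlonglongrightarrow>
    (LINT x|lebesgue_on \<Omega>. h x * indicator (box a b) x)"
  proof (rule integral_dominated_convergence[where w = "\<lambda>x. norm (h x)"])
    have "indicator (box a b) \<in> borel_measurable (lebesgue_on \<Omega>)"
      by (intro measurable_restrict_space1 measurable_completion borel_measurable_indicator) simp
    then show "(\<lambda>x. h x * indicator (box a b) x) \<in> borel_measurable (lebesgue_on \<Omega>)"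
      using h by (intro borel_measurable_times) auto
    show "(\<lambda>x. h x * bump a b n x) \<in> borel_measurable (lebesgue_on \<Omega>)" for n
      using h bump_meas by (intro borel_measurable_times) auto
    show "AE x in lebesgue_on \<Omega>. (\<lambda>n. h x * bump a b n x) \<longlonglongrightarrow> h x * indicator (box a b) x"
      by (intro AE_I2 tendsto_mult tendsto_const bump_tendsto)
    show "AE x in lebesgue_on \<Omega>. norm (h x * bump a b n x) \<le> norm (h x)" for n
      using bump_bounds[of a b n] by (auto simp: abs_mult mult_left_le)
  qed (use h in simp)
  moreover have "(LINT x|lebesgue_on \<Omega>. h x * bump a b n x) = 0" for n
    by (rule zero[OF bump_test_function[OF assms(4)]])
  ultimately have 0: "(LINT x|lebesgue_on \<Omega>. h x * indicator (box a b) x) = 0"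
    by (simp add: LIMSEQ_const_iff)
  have int: "integrable lebesgue ?H"
    using h by (simp add: integrable_restrict_space indicator_def of_bool_def if_distrib if_distribR cong: if_cong)
  have "integral (cbox a b) ?H = integral (box a b) ?H"
    by (rule integral_open_interval[symmetric])
  also have "\<dots> = integral\<^sup>L (lebesgue_on (box a b)) ?H"
    using int by (intro lebesgue_integral_eq_integral[symmetric])
      (simp_all add: integrable_restrict_space integrable_mult_indicator del: real_scaleR_def)
  also have "\<dots> = (LINT x|lebesgue_on \<Omega>. h x * indicator (box a b) x)"
    by (simp add: integral_restrict_space)
       (auto intro!: Bochner_Integration.integral_cong simp: indicator_def)
  finally show ?thesis
    using 0 by simp
qed

text \<open>By Lebesgue differentiation, almost every value of \<open>h\<close> is the limit of its
  means over small cubes with lower corner at that point. Such cubes eventually lie in the open set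
  \<Omega>, and there the means vanish by the preceding lemma.\<close>

lemma AE_eq_0_if_test_functions:
  fixes h :: "real^'n \<Rightarrow> real"
  assumes "open \<Omega>" and h: "integrable (lebesgue_on \<Omega>) h"
    and zero: "\<And>\<phi>. \<phi> \<in> test_functions \<Omega> \<Longrightarrow> (LINT x|lebesgue_on \<Omega>. h x * \<phi> x) = 0"
  shows "AE x in lebesgue_on \<Omega>. h x = 0"
proof -
  have [simp]: "\<Omega> \<in> sets lebesgue"
    using \<open>open \<Omega>\<close> by simp
  let ?H = "\<lambda>x. if x \<in> \<Omega> then h x else 0"
  have int: "integrable lebesgue ?H"
    using h by (simp add: integrable_restrict_space indicator_def of_bool_def if_distrib if_distribR cong: if_cong)
  then have "?H integrable_on UNIV"
    by (simp add: integrable_on_lebesgue)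
  then have "?H integrable_on cbox a b" for a b
    by (rule integrable_on_subcbox) simp
  then have "\<exists>N. negligible N \<and> (\<forall>x e. x \<notin> N \<longrightarrow> 0 < e \<longrightarrow> (\<exists>d>0. \<forall>t. 0 < t \<and> t < d \<longrightarrow>
       norm (integral (cbox x (x + t *\<^sub>R One)) ?H /\<^sub>R t ^ DIM(real^'n) - ?H x) < e))"
    by (rule integrable_ccontinuous_explicit) blast
  then obtain N where N: "negligible N"
    "\<And>x e. x \<notin> N \<Longrightarrow> 0 < e \<Longrightarrow> \<exists>d>0. \<forall>t. 0 < t \<and> t < d \<longrightarrow>
       norm (integral (cbox x (x + t *\<^sub>R One)) ?H /\<^sub>R t ^ DIM(real^'n) - ?H x) < e"
    by blast
  have "h x = 0" if x: "x \<in> \<Omega>" "x \<notin> N" for x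
  proof (rule ccontr)
    assume "h x \<noteq> 0"
    then obtain d where d: "d > 0" "\<And>t. 0 < t \<Longrightarrow> t < d \<Longrightarrow>
       norm (integral (cbox x (x + t *\<^sub>R One)) ?H /\<^sub>R t ^ DIM(real^'n) - ?H x) < norm (h x)"
      using N(2)[OF x(2), of "norm (h x)"] by auto
    obtain r where r: "r > 0" "cball x r \<subseteq> \<Omega>"
      using \<open>open \<Omega>\<close> x(1) open_contains_cball by blast
    \<comment> \<open>The side length is below \<open>d\<close>, and the diagonal
      \<open>t * norm One\<close> is at most \<open>r\<close>, so the cube fits into the ball inside
      \<Omega>.\<close>
    define t where "t = min (d / 2) (r / (norm (One :: real^'n) + 1))"
    have pos: "norm (One :: real^'n) + 1 > 0"
      by (simp add: add_nonneg_pos)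
    then have t: "0 < t" "t < d" "t \<le> r / (norm (One :: real^'n) + 1)"
      using d(1) r(1) by (auto simp: t_def)
    have "t * norm (One :: real^'n) \<le> t * (norm (One :: real^'n) + 1)"
      using t(1) by simp
    also have "\<dots> \<le> r"
      using t(3) pos by (simp add: le_divide_eq)
    finally have tr: "t * norm (One :: real^'n) \<le> r" .
    have "cbox x (x + t *\<^sub>R One) \<subseteq> cball x r"
    proof
      fix y assume "y \<in> cbox x (x + t *\<^sub>R One)"
      then have "norm (y - x) \<le> norm (t *\<^sub>R (One :: real^'n))"
        by (intro norm_le_componentwise) (auto simp: mem_box inner_diff_left inner_add_left abs_le_iff)
      then show "y \<in> cball x r"
        using tr t(1) by (simp add: dist_norm norm_minus_commute)
    qed
    then have "cbox x (x + t *\<^sub>R One) \<subseteq> \<Omega>"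
      using r(2) by blast
    from integral_box_eq_0[OF assms this] d(2)[OF t(1,2)] x(1) show False
      by simp
  qed
  moreover have "AE x in lebesgue. x \<notin> N"
    using N(1) by (intro AE_not_in) (simp add: negligible_iff_null_sets)
  ultimately show ?thesis
    by (auto simp: AE_restrict_space_iff elim!: eventually_mono)
qed

section \<open>Integration by parts for compactly supported functions\<close>

lemma integrable_compact_support:
  fixes u :: "'a::euclidean_space \<Rightarrow> real"
  assumes "continuous_on UNIV u" "\<And>x. x \<notin> cball 0 R \<Longrightarrow> u x = 0"
  shows "integrable lborel u"
proof -
  have "integrable lborel (\<lambda>x. indicator (cball 0 R) x *\<^sub>R u x)"
    using assms(1) by (intro borel_integrable_compact) (auto intro: continuous_on_subset)
  moreover have "(\<lambda>x. indicator (cball 0 R) x *\<^sub>R u x) = u"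
    using assms(2) by (force simp: indicator_def)
  ultimately show ?thesis
    by simp
qed

lemma bounded_compact_support:
  fixes u :: "'a::euclidean_space \<Rightarrow> real"
  assumes "continuous_on UNIV u" "\<And>x. x \<notin> cball 0 R \<Longrightarrow> u x = 0"
  obtains M where "\<And>x. \<bar>u x\<bar> \<le> M"
proof -
  have "bounded (u ` cball 0 R)"
    using assms(1) by (intro compact_imp_bounded compact_continuous_image) (auto intro: continuous_on_subset)
  then obtain M where "\<forall>x\<in>cball 0 R. \<bar>u x\<bar> \<le> M"
    by (auto simp: bounded_iff)
  with assms(2) have "\<bar>u x\<bar> \<le> max M 0" for x
    by (cases "x \<in> cball 0 R") (simp_all add: le_max_iff_disj)
  then show ?thesis
    by (rule that)
qed

lemma line_has_derivative:
  fixes u :: "real^'n \<Rightarrow> real"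
  assumes "u differentiable (at (x + t *\<^sub>R axis j 1))"
  shows "((\<lambda>t. u (x + t *\<^sub>R axis j 1)) has_real_derivative
    partial_deriv j u (x + t *\<^sub>R axis j 1)) (at t)"
proof -
  let ?F = "frechet_derivative u (at (x + t *\<^sub>R axis j 1))"
  have F: "(u has_derivative ?F) (at (x + t *\<^sub>R axis j 1))"
    using assms frechet_derivative_works by blast
  have "((\<lambda>t. x + t *\<^sub>R axis j 1) has_derivative (\<lambda>s. s *\<^sub>R axis j 1)) (at t)"
    by (auto intro!: derivative_eq_intros)
  from has_derivative_compose[OF this F]
  have "((\<lambda>t. u (x + t *\<^sub>R axis j 1)) has_derivative (\<lambda>s. ?F (s *\<^sub>R axis j 1))) (at t)" .
  moreover have "(\<lambda>s. ?F (s *\<^sub>R axis j 1)) = (*) (partial_deriv j u (x + t *\<^sub>R axis j 1))"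
    using linear_cmul[OF has_derivative_linear[OF F]] by (auto simp: partial_deriv_def)
  ultimately show ?thesis
    by (simp add: has_field_derivative_def)
qed

lemma partial_deriv_eq_0_outside:
  assumes "x \<notin> closure {x. u x \<noteq> 0}"
  shows "partial_deriv j u x = 0"
proof -
  let ?S = "- closure {x. u x \<noteq> 0}"
  have "(u has_derivative (\<lambda>_. 0)) (at x)"
  proof (rule has_derivative_transform_within_open)
    show "((\<lambda>_. 0) has_derivative (\<lambda>_. 0)) (at x)"
      by (rule has_derivative_const)
    show "open ?S" "x \<in> ?S"
      using assms by auto
    show "0 = u y" if "y \<in> ?S" for y
      using that closure_subset[of "{x. u x \<noteq> 0}"] by auto
  qed
  from frechet_derivative_at[OF this, symmetric] show ?thesis
    by (simp add: partial_deriv_def)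
qed

text \<open>Translation invariance takes the place of Fubini: the difference quotients of
  \<open>u\<close> in direction \<open>j\<close> all have integral 0, and they converge to the
  partial derivative under a common integrable bound.\<close>

lemma integral_partial_deriv_eq_0:
  fixes u :: "real^'n \<Rightarrow> real"
  assumes diff: "\<And>x. u differentiable (at x)" and cont: "continuous_on UNIV (partial_deriv j u)"
    and supp: "\<And>x. x \<notin> cball 0 R \<Longrightarrow> u x = 0"
  shows "(LINT x|lborel. partial_deriv j u x) = 0"
proof -
  let ?D = "partial_deriv j u" and ?e = "axis j 1 :: real^'n"
  define h where "h n = inverse (real (Suc n))" for n
  have h: "0 < h n" "h n \<le> 1" for n
    by (auto simp: h_def inverse_le_1_iff simp del: of_nat_Suc)
  have cont_u: "continuous_on UNIV u"
    using diff by (intro continuous_at_imp_continuous_on) (auto dest: differentiable_imp_continuous_within)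
  have suppD: "?D x = 0" if "x \<notin> cball 0 R" for x
  proof (rule partial_deriv_eq_0_outside)
    have "{x. u x \<noteq> 0} \<subseteq> cball 0 R"
      using supp by blast
    then have "closure {x. u x \<noteq> 0} \<subseteq> cball 0 R"
      by (rule closure_minimal) simp
    then show "x \<notin> closure {x. u x \<noteq> 0}"
      using that by blast
  qed
  obtain M where M: "\<And>x. \<bar>?D x\<bar> \<le> M"
    using bounded_compact_support[OF cont suppD] by blast
  have M0: "M \<ge> 0"
    using M[of 0] by linarith
  have int_u: "integrable lborel u"
    by (rule integrable_compact_support[OF cont_u supp])
  have meas_u[measurable]: "u \<in> borel_measurable borel"
    using cont_u by (rule borel_measurable_continuous_onI)
  have shift: "integrable lborel (\<lambda>x. u (c + x))" "(LINT x|lborel. u (c + x)) = (LINT x|lborel. u x)" for c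
  proof -
    have "integrable (distr lborel borel ((+) c)) u"
      unfolding lborel_distr_plus by (rule int_u)
    then show "integrable lborel (\<lambda>x. u (c + x))"
      by (subst (asm) integrable_distr_eq) auto
    have "(LINT x|lborel. u x) = (LINT x|distr lborel borel ((+) c). u x)"
      unfolding lborel_distr_plus ..
    also have "\<dots> = (LINT x|lborel. u (c + x))"
      by (rule integral_distr) auto
    finally show "(LINT x|lborel. u (c + x)) = (LINT x|lborel. u x)" ..
  qed
  have "(\<lambda>n. LINT x|lborel. (u (h n *\<^sub>R ?e + x) - u x) / h n) \<longlonglongrightarrow> (LINT x|lborel. ?D x)"
  \<comment> \<open>The mean value theorem bounds the quotients by \<open>M\<close>. Since
    \<open>h n \<le> 1\<close>, they all vanish outside the ball of radius
    \<open>R + 1\<close>.\<close>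
  proof (rule integral_dominated_convergence[where w = "\<lambda>x. M * indicator (cball 0 (R + 1)) x"])
    show "?D \<in> borel_measurable lborel"
      using cont by (simp add: borel_measurable_continuous_onI)
    show "(\<lambda>x. (u (h n *\<^sub>R ?e + x) - u x) / h n) \<in> borel_measurable lborel" for n
      by measurable
    show "integrable lborel (\<lambda>x :: real^'n. M * indicator (cball 0 (R + 1)) x)"
      using emeasure_lborel_cball_finite[of "0 :: real^'n" "R + 1"]
      by (intro integrable_mult_right integrable_real_indicator) auto
    show "AE x in lborel. (\<lambda>n. (u (h n *\<^sub>R ?e + x) - u x) / h n) \<longlonglongrightarrow> ?D x"
    proof (rule AE_I2)
      fix x
      have "((\<lambda>t. u (x + t *\<^sub>R ?e)) has_real_derivative ?D x) (at 0)"
        using line_has_derivative[of u x 0 j] diff by simp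
      then have "((\<lambda>t. (u (x + t *\<^sub>R ?e) - u x) / t) \<longlongrightarrow> ?D x) (at 0)"
        by (simp add: DERIV_def)
      moreover have "filterlim h (at 0) sequentially"
        using LIMSEQ_inverse_real_of_nat h(1)
        by (auto simp: filterlim_at h_def[abs_def] intro!: always_eventually)
      ultimately have "(\<lambda>n. (u (x + h n *\<^sub>R ?e) - u x) / h n) \<longlonglongrightarrow> ?D x"
        by (rule filterlim_compose)
      then show "(\<lambda>n. (u (h n *\<^sub>R ?e + x) - u x) / h n) \<longlonglongrightarrow> ?D x"
        by (simp only: add.commute[of x])
    qed
    show "AE x in lborel. norm ((u (h n *\<^sub>R ?e + x) - u x) / h n) \<le> M * indicator (cball 0 (R + 1)) x" for n
    proof (rule AE_I2)
      fix x
      show "norm ((u (h n *\<^sub>R ?e + x) - u x) / h n) \<le> M * indicator (cball 0 (R + 1)) x"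
      proof (cases "x \<in> cball 0 (R + 1)")
        case True
        have "\<exists>z>0. z < h n \<and> u (x + h n *\<^sub>R ?e) - u (x + 0 *\<^sub>R ?e) = (h n - 0) * ?D (x + z *\<^sub>R ?e)"
          by (rule MVT2[OF h(1)]) (rule line_has_derivative[OF diff])
        then obtain z where "u (x + h n *\<^sub>R ?e) - u x = h n * ?D (x + z *\<^sub>R ?e)"
          by auto
        then show ?thesis
          using True M h(1)[of n] by (simp add: add.commute[of _ x])
      next
        case False
        have "norm (h n *\<^sub>R ?e) \<le> 1"
          using h[of n] by simp
        with False have "norm (h n *\<^sub>R ?e + x) > R"
          using norm_diff_ineq[of x "h n *\<^sub>R ?e"] by (simp add: add.commute)
        then show ?thesis
          using False supp[of x] supp[of "h n *\<^sub>R ?e + x"] by simp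
      qed
    qed
  qed
  moreover have "(LINT x|lborel. (u (h n *\<^sub>R ?e + x) - u x) / h n) = 0" for n
    using shift[of "h n *\<^sub>R ?e"] int_u by (simp add: Bochner_Integration.integral_diff)
  ultimately have "(\<lambda>_ :: nat. 0) \<longlonglongrightarrow> (LINT x|lborel. ?D x)"
    by (simp only:)
  then show ?thesis
    by (simp add: LIMSEQ_const_iff)
qed

lemma test_functionD:
  fixes \<phi> :: "real^'n \<Rightarrow> real"
  assumes "\<phi> \<in> test_functions \<Omega>"
  shows "\<phi> differentiable (at x)" "continuous_on UNIV \<phi>" "continuous_on UNIV (partial_deriv j \<phi>)"
    "x \<notin> \<Omega> \<Longrightarrow> \<phi> x = 0" "x \<notin> \<Omega> \<Longrightarrow> partial_deriv j \<phi> x = 0"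
    "\<exists>R. \<forall>x. x \<notin> cball 0 R \<longrightarrow> \<phi> x = 0 \<and> (\<forall>j. partial_deriv j \<phi> x = 0)"
proof -
  have C: "C_k k \<phi>" and cpt: "compact (closure {x. \<phi> x \<noteq> 0})"
    and sub: "closure {x. \<phi> x \<noteq> 0} \<subseteq> \<Omega>" for k
    using assms by (auto simp: test_functions_def)
  show "continuous_on UNIV \<phi>"
    using C[of 0] by simp
  show "\<phi> differentiable (at x)" "continuous_on UNIV (partial_deriv j \<phi>)"
    using C[of "Suc 0"] by simp_all
  have zero: "\<phi> x = 0 \<and> (\<forall>j. partial_deriv j \<phi> x = 0)" if "x \<notin> closure {x. \<phi> x \<noteq> 0}" for x
    using that closure_subset[of "{x. \<phi> x \<noteq> 0}"] partial_deriv_eq_0_outside[OF that] by auto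
  then show "\<phi> x = 0" "partial_deriv j \<phi> x = 0" if "x \<notin> \<Omega>"
    using that sub by blast+
  obtain R where "closure {x. \<phi> x \<noteq> 0} \<subseteq> cball 0 R"
    using compact_imp_bounded[OF cpt] by (auto simp: bounded_iff subset_iff)
  then show "\<exists>R. \<forall>x. x \<notin> cball 0 R \<longrightarrow> \<phi> x = 0 \<and> (\<forall>j. partial_deriv j \<phi> x = 0)"
    using zero by blast
qed

lemma integral_lebesgue_on_eq_lborel:
  fixes f :: "'a::euclidean_space \<Rightarrow> real"
  assumes "open \<Omega>" "continuous_on UNIV f" "\<And>x. x \<notin> \<Omega> \<Longrightarrow> f x = 0"
  shows "(LINT x|lebesgue_on \<Omega>. f x) = (LINT x|lborel. f x)"
proof -
  have "(LINT x|lebesgue_on \<Omega>. f x) = (LINT x|lebesgue. f x)"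
    using assms by (subst integral_restrict_space)
      (auto intro!: Bochner_Integration.integral_cong simp: indicator_def)
  also have "\<dots> = (LINT x|lborel. f x)"
    using assms(2) by (intro integral_completion) (simp add: borel_measurable_continuous_onI)
  finally show ?thesis .
qed

text \<open>The product \<open>l x * \<phi> x\<close> has compact support, so its partial derivative
  integrates to 0, and the product rule splits that integral into the two terms. Both integrands
  vanish off \<Omega>, hence the restriction to \<Omega> changes nothing.\<close>

lemma integral_linear_times_partial_deriv:
  fixes \<phi> :: "real^'n \<Rightarrow> real"
  assumes "open \<Omega>" and \<phi>: "\<phi> \<in> test_functions \<Omega>" and l: "bounded_linear l"
  shows "(LINT x|lebesgue_on \<Omega>. l x * partial_deriv j \<phi> x) =
    - (LINT x|lebesgue_on \<Omega>. l (axis j 1) * \<phi> x)"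
proof -
  note D = test_functionD[OF \<phi>]
  obtain R where R: "\<And>x. x \<notin> cball 0 R \<Longrightarrow> \<phi> x = 0" "\<And>x j. x \<notin> cball 0 R \<Longrightarrow> partial_deriv j \<phi> x = 0"
    using D(6) by blast
  have cont_l: "continuous_on UNIV l"
    using l by (simp add: linear_continuous_on)
  have der: "((\<lambda>x. l x * \<phi> x) has_derivative (\<lambda>y. l x * frechet_derivative \<phi> (at x) y + l y * \<phi> x)) (at x)" for x
  proof -
    have "(\<phi> has_derivative frechet_derivative \<phi> (at x)) (at x)"
      using D(1)[of x] frechet_derivative_works by blast
    from has_derivative_mult[OF bounded_linear_imp_has_derivative[OF l] this] show ?thesis .
  qed
  have pd: "partial_deriv j (\<lambda>x. l x * \<phi> x) = (\<lambda>x. l x * partial_deriv j \<phi> x + l (axis j 1) * \<phi> x)"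
    unfolding partial_deriv_def frechet_derivative_at[OF der, symmetric] ..
  have cont1: "continuous_on UNIV (\<lambda>x. l x * partial_deriv j \<phi> x)"
    by (intro continuous_on_mult cont_l D)
  have cont2: "continuous_on UNIV (\<lambda>x. l (axis j 1) * \<phi> x)"
    by (intro continuous_on_mult continuous_on_const D)
  have "(LINT x|lborel. partial_deriv j (\<lambda>x. l x * \<phi> x) x) = 0"
  proof (rule integral_partial_deriv_eq_0)
    show "(\<lambda>x. l x * \<phi> x) differentiable (at x)" for x
      using der differentiableI by blast
    show "continuous_on UNIV (partial_deriv j (\<lambda>x. l x * \<phi> x))"
      unfolding pd by (intro continuous_on_add cont1 cont2)
    show "l x * \<phi> x = 0" if "x \<notin> cball 0 R" for x
      using R(1)[OF that] by simp
  qed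
  moreover have "integrable lborel (\<lambda>x. l x * partial_deriv j \<phi> x)"
    by (rule integrable_compact_support[OF cont1, of R]) (metis R mult_zero_right)
  moreover have "integrable lborel (\<lambda>x. l (axis j 1) * \<phi> x)"
    by (rule integrable_compact_support[OF cont2, of R]) (metis R mult_zero_right)
  ultimately have "(LINT x|lborel. l x * partial_deriv j \<phi> x) + (LINT x|lborel. l (axis j 1) * \<phi> x) = 0"
    unfolding pd by (simp only: Bochner_Integration.integral_add)
  moreover have "(LINT x|lebesgue_on \<Omega>. l x * partial_deriv j \<phi> x) = (LINT x|lborel. l x * partial_deriv j \<phi> x)"
    by (rule integral_lebesgue_on_eq_lborel[OF \<open>open \<Omega>\<close> cont1]) (simp add: D(5))
  moreover have "(LINT x|lebesgue_on \<Omega>. l (axis j 1) * \<phi> x) = (LINT x|lborel. l (axis j 1) * \<phi> x)"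
    by (rule integral_lebesgue_on_eq_lborel[OF \<open>open \<Omega>\<close> cont2]) (simp add: D(4))
  ultimately show ?thesis
    by linarith
qed

section \<open>Weak gradients and strains of linear fields\<close>

lemma integrable_lebesgue_on_continuous:
  fixes f :: "'a::euclidean_space \<Rightarrow> real"
  assumes "open \<Omega>" "bounded \<Omega>" "continuous_on UNIV f"
  shows "integrable (lebesgue_on \<Omega>) f"
proof -
  have "compact (closure \<Omega>)"
    using assms(2) by (simp add: compact_closure)
  then have "compact (f ` closure \<Omega>)"
    using assms(3) by (intro compact_continuous_image) (rule continuous_on_subset, auto)
  then obtain M where M: "\<forall>y\<in>f ` closure \<Omega>. norm y \<le> M"
    using compact_imp_bounded bounded_iff by metis
  have "\<Omega> \<in> lmeasurable"
    using assms(1,2) by (rule lmeasurable_open[rotated])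
  then interpret finite_measure "lebesgue_on \<Omega>"
    by (rule finite_measure_lebesgue_on)
  have meas: "f \<in> borel_measurable (lebesgue_on \<Omega>)"
    using assms(3) by (intro measurable_restrict_space1 measurable_completion)
      (simp add: borel_measurable_continuous_onI)
  show ?thesis
    by (rule integrable_const_bound[OF _ meas, of M])
      (use M closure_subset[of \<Omega>] in \<open>auto intro!: AE_I2\<close>)
qed

lemma (in finite_measure) square_integrable_imp_integrable:
  assumes "square_integrable M f"
  shows "integrable M f"
proof (rule Bochner_Integration.integrable_bound)
  show "integrable M (\<lambda>x. 1 + (norm (f x))\<^sup>2)"
    using assms by (simp add: square_integrable_def)
  show "f \<in> borel_measurable M"
    using assms by (simp add: square_integrable_def)
  have "a \<le> 1 + a\<^sup>2" for a :: real
    using zero_le_power2[of "a - 1 / 2"] by (simp add: power2_diff power_divide)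
  then show "AE x in M. norm (f x) \<le> norm (1 + (norm (f x))\<^sup>2)"
    by (simp add: abs_of_nonneg)
qed

text \<open>The entries of the difference integrate to 0 against every test function. Boundedness of
  \<Omega> makes them integrable, and the fundamental lemma applies.\<close>

lemma weak_gradient_unique:
  assumes "open \<Omega>" "bounded \<Omega>" and G: "is_weak_gradient \<Omega> v G" and G': "is_weak_gradient \<Omega> v G'"
  shows "AE x in lebesgue_on \<Omega>. G x = G' x"
proof -
  have "\<Omega> \<in> lmeasurable"
    using assms(1,2) by (rule lmeasurable_open[rotated])
  then interpret finite_measure "lebesgue_on \<Omega>"
    by (rule finite_measure_lebesgue_on)
  have component: "integrable (lebesgue_on \<Omega>) (\<lambda>x. H x $ i $ j)" if "is_weak_gradient \<Omega> v H" for H i j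
  proof -
    have "bounded_linear (\<lambda>A :: real^_^_. A $ i $ j)"
      using bounded_linear_compose[OF bounded_linear_vec_nth bounded_linear_vec_nth] .
    moreover have "integrable (lebesgue_on \<Omega>) H"
      using that by (intro square_integrable_imp_integrable) (simp add: is_weak_gradient_def)
    ultimately show ?thesis
      by (rule integrable_bounded_linear)
  qed
  have "AE x in lebesgue_on \<Omega>. G x $ i $ j - G' x $ i $ j = 0" for i j
  proof (rule AE_eq_0_if_test_functions[OF assms(1)])
    show "integrable (lebesgue_on \<Omega>) (\<lambda>x. G x $ i $ j - G' x $ i $ j)"
      by (intro Bochner_Integration.integrable_diff component G G')
    fix \<phi> assume \<phi>: "\<phi> \<in> test_functions \<Omega>"
    \<comment> \<open>Test functions are bounded. This integrability allows the integral of the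
      difference to be split.\<close>
    have int: "integrable (lebesgue_on \<Omega>) (\<lambda>x. H x $ i $ j * \<phi> x)" if H: "is_weak_gradient \<Omega> v H" for H
    proof -
      obtain R where "\<And>x. x \<notin> cball 0 R \<Longrightarrow> \<phi> x = 0"
        using test_functionD(6)[OF \<phi>] by blast
      then obtain M where M: "\<And>x. \<bar>\<phi> x\<bar> \<le> M"
        using bounded_compact_support[OF test_functionD(2)[OF \<phi>]] by blast
      show ?thesis
      proof (rule Bochner_Integration.integrable_bound)
        show "integrable (lebesgue_on \<Omega>) (\<lambda>x. M * (H x $ i $ j))"
          by (intro integrable_mult_right component H)
        have "\<phi> \<in> borel_measurable (lebesgue_on \<Omega>)"
          using test_functionD(2)[OF \<phi>] by (intro measurable_restrict_space1 measurable_completion)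
            (simp add: borel_measurable_continuous_onI)
        then show "(\<lambda>x. H x $ i $ j * \<phi> x) \<in> borel_measurable (lebesgue_on \<Omega>)"
          using component[OF H, of i j] by (intro borel_measurable_times) auto
        have "norm (H x $ i $ j * \<phi> x) \<le> norm (M * (H x $ i $ j))" for x
          using mult_right_mono[OF order_trans[OF M[of x] abs_ge_self], of "\<bar>H x $ i $ j\<bar>"]
          by (simp add: abs_mult mult.commute)
        then show "AE x in lebesgue_on \<Omega>. norm (H x $ i $ j * \<phi> x) \<le> norm (M * (H x $ i $ j))"
          by simp
      qed
    qed
    have "(LINT x|lebesgue_on \<Omega>. G x $ i $ j * \<phi> x) = - (LINT x|lebesgue_on \<Omega>. v x $ i * partial_deriv j \<phi> x)"
      using G \<phi> by (simp add: is_weak_gradient_def)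
    also have "\<dots> = (LINT x|lebesgue_on \<Omega>. G' x $ i $ j * \<phi> x)"
      using G' \<phi> by (simp add: is_weak_gradient_def)
    finally show "(LINT x|lebesgue_on \<Omega>. (G x $ i $ j - G' x $ i $ j) * \<phi> x) = 0"
      by (simp add: left_diff_distrib int[OF G] int[OF G'])
  qed
  then have "AE x in lebesgue_on \<Omega>. \<forall>i j. G x $ i $ j - G' x $ i $ j = 0"
    by (simp add: AE_all_countable)
  then show ?thesis
    by (auto simp: vec_eq_iff elim!: eventually_mono)
qed

lemma is_weak_gradient_linear:
  fixes B :: "real^'n^'n"
  assumes "open \<Omega>" "bounded \<Omega>"
  shows "is_weak_gradient \<Omega> ((*v) B) (\<lambda>_. B)"
proof -
  have "\<Omega> \<in> lmeasurable"
    using assms by (rule lmeasurable_open[rotated])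
  then interpret finite_measure "lebesgue_on \<Omega>"
    by (rule finite_measure_lebesgue_on)
  have "(LINT x|lebesgue_on \<Omega>. (B *v x) $ i * partial_deriv j \<phi> x) =
      - (LINT x|lebesgue_on \<Omega>. B $ i $ j * \<phi> x)" if "\<phi> \<in> test_functions \<Omega>" for \<phi> i j
  proof -
    have "bounded_linear (\<lambda>x. (B *v x) $ i)"
      by (rule bounded_linear_compose[OF bounded_linear_vec_nth matrix_vector_mul_bounded_linear])
    moreover have "(B *v axis j 1) $ i = B $ i $ j"
      by (simp add: matrix_vector_mult_basis column_def)
    ultimately show ?thesis
      using integral_linear_times_partial_deriv[OF assms(1) that, of "\<lambda>x. (B *v x) $ i" j] by simp
  qed
  then show ?thesis
    by (simp add: is_weak_gradient_def square_integrable_def)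
qed

lemma continuous_on_matrix_vector_mult: "continuous_on S ((*v) (B :: real^'n^'m))"
  by (simp add: linear_continuous_on)

lemma linear_in_H1:
  fixes B :: "real^'n^'n"
  assumes "open \<Omega>" "bounded \<Omega>"
  shows "(*v) B \<in> H1 \<Omega>"
proof -
  have "(*v) B \<in> borel_measurable (lebesgue_on \<Omega>)"
    by (intro measurable_restrict_space1 measurable_completion)
      (simp add: borel_measurable_continuous_onI continuous_on_matrix_vector_mult)
  moreover have "integrable (lebesgue_on \<Omega>) (\<lambda>x. (norm (B *v x))\<^sup>2)"
    by (intro integrable_lebesgue_on_continuous assms continuous_on_power continuous_on_norm
        continuous_on_matrix_vector_mult)
  ultimately show ?thesis
    using is_weak_gradient_linear[OF assms] by (auto simp: H1_def square_integrable_def)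
qed

text \<open>The choice operator in \<open>weak_gradient\<close> picks some weak gradient, and
  uniqueness identifies it with \<open>B\<close> only off a null set. For symmetric \<open>B\<close>
  symmetrization changes nothing.\<close>

lemma strain_linear:
  fixes B :: "real^'n^'n"
  assumes "open \<Omega>" "bounded \<Omega>" "transpose B = B"
  shows "AE x in lebesgue_on \<Omega>. strain \<Omega> ((*v) B) x = B"
proof -
  have "is_weak_gradient \<Omega> ((*v) B) (weak_gradient \<Omega> ((*v) B))"
    unfolding weak_gradient_def
    by (rule someI[where P = "is_weak_gradient \<Omega> ((*v) B)", OF is_weak_gradient_linear[OF assms(1,2)]])
  from weak_gradient_unique[OF assms(1,2) this is_weak_gradient_linear[OF assms(1,2)]]
  show ?thesis
    using assms(3) by (auto simp: strain_def simp flip: scaleR_2 elim!: eventually_mono)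
qed

section \<open>Boundary traces and loads of continuous fields\<close>

lemma boundary_trace_continuous:
  fixes v :: "real^'n \<Rightarrow> real^'n"
  assumes "open \<Omega>" "x \<in> frontier \<Omega>" and v: "continuous_on UNIV v"
  shows "boundary_trace \<Omega> v x = v x"
proof -
  define S where "S r = \<Omega> \<inter> ball x r" for r
  define mean where "mean z r = (LINT y|lebesgue_on (S r). norm (v y - z)) / measure lebesgue (S r)" for z r
  have S: "open (S r)" "bounded (S r)" "S r \<in> lmeasurable" for r
    using assms(1) by (auto simp: S_def intro!: open_Int bounded_Int lmeasurable_open)
  \<comment> \<open>A boundary point is in the closure of \<Omega>, so \<open>S r\<close> is a
    nonempty open set; the means are then not divisions by 0.\<close>
  have pos: "measure lebesgue (S r) > 0" if "r > 0" for r
  proof -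
    have "x \<in> closure \<Omega>"
      using assms(2) by (simp add: frontier_def)
    then obtain y where "y \<in> \<Omega>" "dist y x < r"
      using \<open>r > 0\<close> by (auto simp: closure_approachable)
    then have "y \<in> S r"
      by (simp add: S_def dist_commute)
    then have "S r \<noteq> {}"
      by blast
    then have "\<not> negligible (S r)"
      using S(1) open_not_negligible by blast
    then show ?thesis
      using S(3) by (simp add: negligible_iff_measure zero_less_measure_iff)
  qed
  have int: "integrable (lebesgue_on (S r)) (\<lambda>y. norm (v y - z))" for r z
    by (intro integrable_lebesgue_on_continuous S continuous_intros v)
  have const: "(LINT y|lebesgue_on (S r). c) = c * measure lebesgue (S r)"
    "integrable (lebesgue_on (S r)) (\<lambda>_. c)" for c :: real and r
  proof -
    interpret finite_measure "lebesgue_on (S r)"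
      by (rule finite_measure_lebesgue_on[OF S(3)])
    show "integrable (lebesgue_on (S r)) (\<lambda>_. c)"
      by simp
    show "(LINT y|lebesgue_on (S r). c) = c * measure lebesgue (S r)"
      using S(3) by (simp add: measure_restrict_space)
  qed
  have le: "mean z r \<le> c" if "r > 0" "\<And>y. y \<in> S r \<Longrightarrow> norm (v y - z) \<le> c" for z r c
  proof -
    have "(LINT y|lebesgue_on (S r). norm (v y - z)) \<le> (LINT y|lebesgue_on (S r). c)"
      using that(2) by (intro integral_mono int const) simp
    then show ?thesis
      unfolding const(1) mean_def using pos[OF that(1)] by (simp add: divide_le_eq)
  qed
  have nonneg: "0 \<le> mean z r" for z r
    by (simp add: mean_def)
  \<comment> \<open>Existence of the value described by \<open>THE\<close>: near \<open>x\<close>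
    the integrand is small by continuity.\<close>
  have lim: "(mean (v x) \<longlongrightarrow> 0) (at_right 0)"
  proof (rule tendstoI)
    fix e :: real assume "e > 0"
    then obtain d where d: "d > 0" "\<And>y. dist y x < d \<Longrightarrow> dist (v y) (v x) < e / 2"
      using v[unfolded continuous_on_iff, rule_format, of x "e / 2"] by auto
    have "dist (mean (v x) r) 0 < e" if "0 < r" "r < d" for r
    proof -
      have "mean (v x) r \<le> e / 2"
        using d(2) that by (intro le) (auto simp: S_def dist_norm norm_minus_commute less_imp_le)
      with nonneg[of "v x" r] \<open>e > 0\<close> show ?thesis
        by simp
    qed
    then show "\<forall>\<^sub>F r in at_right 0. dist (mean (v x) r) 0 < e"
      using d(1) by (auto simp: eventually_at_right_field)
  qed
  \<comment> \<open>Uniqueness: averaging the triangle inequality bounds the constant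
    \<open>norm (z - v x)\<close> by a sum of two means that both tend to 0.\<close>
  have "z = v x" if "(mean z \<longlongrightarrow> 0) (at_right 0)" for z
  proof -
    have "norm (z - v x) \<le> mean z r + mean (v x) r" if "r > 0" for r
    proof -
      have "norm (z - v x) * measure lebesgue (S r) = (LINT y|lebesgue_on (S r). norm (z - v x))"
        by (rule const(1)[symmetric])
      also have "\<dots> \<le> (LINT y|lebesgue_on (S r). norm (v y - z) + norm (v y - v x))"
      proof (intro integral_mono const Bochner_Integration.integrable_add int)
        show "norm (z - v x) \<le> norm (v y - z) + norm (v y - v x)" for y
          using dist_triangle3[of z "v x" "v y"] by (simp add: dist_norm)
      qed
      also have "\<dots> = (LINT y|lebesgue_on (S r). norm (v y - z)) + (LINT y|lebesgue_on (S r). norm (v y - v x))"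
        by (rule Bochner_Integration.integral_add[OF int int])
      finally show ?thesis
        using pos[OF that] by (simp add: mean_def le_divide_eq flip: add_divide_distrib)
    qed
    then have "\<forall>\<^sub>F r in at_right 0. norm (z - v x) \<le> mean z r + mean (v x) r"
      by (simp add: eventually_at_filter)
    moreover have "((\<lambda>r. mean z r + mean (v x) r) \<longlongrightarrow> 0 + 0) (at_right 0)"
      by (rule tendsto_add[OF that lim])
    ultimately have "norm (z - v x) \<le> 0 + 0"
      by (intro tendsto_lowerbound[where F = "at_right (0 :: real)"]) auto
    then show ?thesis
      by simp
  qed
  with lim show ?thesis
    unfolding boundary_trace_def mean_def S_def by (rule the_equality)
qed

lemma load_continuous:
  assumes "open \<Omega>" "continuous_on UNIV v"
  shows "load \<Omega> f g v = (LINT x|boundary_measure \<Omega>. f x \<bullet> v x) + (LINT x|lebesgue_on \<Omega>. g x \<bullet> v x)"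
proof -
  have "space (boundary_measure \<Omega>) \<subseteq> frontier \<Omega>"
    by (simp add: boundary_measure_def space_restrict_space)
  then have "(LINT x|boundary_measure \<Omega>. f x \<bullet> boundary_trace \<Omega> v x) = (LINT x|boundary_measure \<Omega>. f x \<bullet> v x)"
    using boundary_trace_continuous[OF assms(1) _ assms(2)]
    by (intro Bochner_Integration.integral_cong) auto
  then show ?thesis
    by (simp add: load_def)
qed

section \<open>Squares of skew-symmetric matrices\<close>

text \<open>The matrix of the cross product with the vector \<open>(a, b, 0)\<close>.\<close>

definition axial_skew :: "real \<Rightarrow> real \<Rightarrow> real^3^3" where
  "axial_skew a b = vector [vector [0, 0, b], vector [0, 0, - a], vector [- b, a, 0]]"

text \<open>For a skew matrix with axial vector \<open>w\<close> the square is
  \<open>w w^T - |w|^2 I\<close>. This is half of it for \<open>w = (a, b, 0)\<close>, with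
  independent parameters \<open>p\<close>, \<open>q\<close>, \<open>r\<close> in place of
  \<open>a^2\<close>, \<open>a b\<close>, \<open>b^2\<close>; the family is thereby linear and
  contains the convex combinations.\<close>

definition axial_strain :: "real \<Rightarrow> real \<Rightarrow> real \<Rightarrow> real^3^3" where
  "axial_strain p q r =
     (1/2) *\<^sub>R vector [vector [- r, q, 0], vector [q, - p, 0], vector [0, 0, - (p + r)]]"

lemma axial_skew_nth:
  "axial_skew a b $ 1 $ 1 = 0" "axial_skew a b $ 1 $ 2 = 0" "axial_skew a b $ 1 $ 3 = b"
  "axial_skew a b $ 2 $ 1 = 0" "axial_skew a b $ 2 $ 2 = 0" "axial_skew a b $ 2 $ 3 = - a"
  "axial_skew a b $ 3 $ 1 = - b" "axial_skew a b $ 3 $ 2 = a" "axial_skew a b $ 3 $ 3 = 0"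
  by (simp_all add: axial_skew_def)

lemma axial_strain_nth:
  "axial_strain p q r $ 1 $ 1 = - r / 2" "axial_strain p q r $ 1 $ 2 = q / 2" "axial_strain p q r $ 1 $ 3 = 0"
  "axial_strain p q r $ 2 $ 1 = q / 2" "axial_strain p q r $ 2 $ 2 = - p / 2" "axial_strain p q r $ 2 $ 3 = 0"
  "axial_strain p q r $ 3 $ 1 = 0" "axial_strain p q r $ 3 $ 2 = 0" "axial_strain p q r $ 3 $ 3 = - (p + r) / 2"
  by (simp_all add: axial_strain_def)

lemma axial_skew_in: "axial_skew a b \<in> skew_matrices"
  by (simp add: skew_matrices_def vec_eq_iff transpose_def forall_3 axial_skew_nth)

lemma half_axial_skew_square:
  "(1/2) *\<^sub>R (axial_skew a b ** axial_skew a b) = axial_strain (a\<^sup>2) (a * b) (b\<^sup>2)"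
  by (simp add: vec_eq_iff matrix_matrix_mult_def forall_3 sum_3 axial_skew_nth axial_strain_nth
      power2_eq_square)

lemma transpose_axial_strain: "transpose (axial_strain p q r) = axial_strain p q r"
  by (simp add: vec_eq_iff transpose_def forall_3 axial_strain_nth)

lemma axial_strain_combination:
  "s *\<^sub>R (axial_strain p q r *v x) + t *\<^sub>R (axial_strain p' q' r' *v x) =
   axial_strain (s * p + t * p') (s * q + t * q') (s * r + t * r') *v x"
  by (simp add: vec_eq_iff matrix_vector_mult_def forall_3 sum_3 axial_strain_nth field_simps)

text \<open>Keeps the arguments of the quadratic forms symmetric, where the coercivity bounds are
  available.\<close>

lemma skew_square_symmetric:
  assumes "W \<in> skew_matrices"
  shows "transpose (W ** W) = W ** W"
proof -
  have "transpose W = - W"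
    using assms by (simp add: skew_matrices_def)
  then have "transpose (W ** W) = (- W) ** (- W)"
    by (simp add: matrix_transpose_mul)
  then show ?thesis
    by (simp add: vec_eq_iff matrix_matrix_mult_def)
qed

section \<open>Distance to the half squares of skew-symmetric matrices\<close>

lemma trace_transpose_mult_self:
  "trace (transpose A ** A) = (\<Sum>j\<in>UNIV. \<Sum>i\<in>UNIV. (A $ i $ j)\<^sup>2)" for A :: "real^'n^'n"
  by (simp add: trace_def matrix_matrix_mult_def transpose_def power2_eq_square)

text \<open>If the difference to some half square were small, then \<open>p\<close>,
  \<open>r\<close>, \<open>q\<close> would be close to \<open>a^2\<close>, \<open>b^2\<close>,
  \<open>a b\<close> for two entries \<open>a\<close>, \<open>b\<close> of \<open>W\<close>, and
  \<open>p * r - q^2\<close> would be close to \<open>a^2 b^2 - (a b)^2 = 0\<close>. The proof makes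
  this quantitative.\<close>

lemma axial_strain_dist:
  assumes "p \<ge> 0" "r \<ge> 0" "p * r - q\<^sup>2 > 0"
  shows "\<exists>c>0. \<forall>W\<in>skew_matrices.
    c \<le> trace (transpose (axial_strain p q r - (1/2) *\<^sub>R (W ** W)) ** (axial_strain p q r - (1/2) *\<^sub>R (W ** W)))"
proof -
  define d where "d = p * r - q\<^sup>2"
  \<comment> \<open>\<open>K\<close> is the sum of the coefficients of \<open>e\<close> in the
    estimates below, which yield \<open>d \<le> e * K\<close>; the choice of \<open>e\<close>
    contradicts this.\<close>
  define K where "K = 5 * (p + r) + 39"
  define e where "e = min 1 (d / (2 * K))"
  have d: "d > 0" and K: "K > 0"
    using assms by (auto simp: d_def K_def)
  have e: "0 < e" "e \<le> 1" "e * K \<le> d / 2"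
  proof -
    show "0 < e" "e \<le> 1"
      using d K by (simp_all add: e_def)
    have "e * K \<le> d / (2 * K) * K"
      using K by (intro mult_right_mono) (simp_all add: e_def)
    also have "\<dots> = d / 2"
      using K by simp
    finally show "e * K \<le> d / 2" .
  qed
  have "e\<^sup>2 \<le> trace (transpose (axial_strain p q r - (1/2) *\<^sub>R (W ** W)) ** (axial_strain p q r - (1/2) *\<^sub>R (W ** W)))"
    if W: "W \<in> skew_matrices" for W
  proof (rule ccontr)
    define C where "C = axial_strain p q r - (1/2) *\<^sub>R (W ** W)"
    \<comment> \<open>The axial vector of \<open>W\<close> is \<open>(a, b, - k)\<close>.\<close>
    define a where "a = - W $ 2 $ 3"
    define b where "b = W $ 1 $ 3"
    define k where "k = W $ 1 $ 2"
    have W': "W $ i $ j = - W $ j $ i" for i j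
    proof -
      have "transpose W $ j $ i = (- W) $ j $ i"
        using W unfolding skew_matrices_def by simp
      then show ?thesis
        unfolding transpose_def by simp
    qed
    have Wd: "W $ 1 $ 1 = 0" "W $ 2 $ 2 = 0" "W $ 3 $ 3 = 0"
      using W'[of 1 1] W'[of 2 2] W'[of 3 3] by linarith+
    have Wo: "W $ 2 $ 1 = - k" "W $ 3 $ 1 = - b" "W $ 3 $ 2 = a" "W $ 1 $ 2 = k" "W $ 1 $ 3 = b" "W $ 2 $ 3 = - a"
      unfolding a_def b_def k_def using W'[of 2 1] W'[of 3 1] W'[of 3 2] by linarith+
    have C: "C $ 1 $ 1 = (k\<^sup>2 + b\<^sup>2 - r) / 2" "C $ 2 $ 2 = (k\<^sup>2 + a\<^sup>2 - p) / 2"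
      "C $ 3 $ 3 = (a\<^sup>2 + b\<^sup>2 - p - r) / 2" "C $ 1 $ 2 = (q - a * b) / 2"
      unfolding C_def
      by (simp_all add: axial_strain_nth matrix_matrix_mult_def sum_3 Wd Wo power2_eq_square
          add_divide_distrib diff_divide_distrib)
    assume "\<not> e\<^sup>2 \<le> trace (transpose (axial_strain p q r - (1/2) *\<^sub>R (W ** W)) ** (axial_strain p q r - (1/2) *\<^sub>R (W ** W)))"
    then have lt: "(\<Sum>j\<in>UNIV. \<Sum>i\<in>UNIV. (C $ i $ j)\<^sup>2) < e\<^sup>2"
      by (simp add: C_def trace_transpose_mult_self)
    have small: "\<bar>C $ i $ j\<bar> \<le> e" for i j
    proof -
      have "(C $ i $ j)\<^sup>2 \<le> (\<Sum>i\<in>UNIV. (C $ i $ j)\<^sup>2)"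
        by (rule member_le_sum) auto
      also have "\<dots> \<le> (\<Sum>j\<in>UNIV. \<Sum>i\<in>UNIV. (C $ i $ j)\<^sup>2)"
        by (rule member_le_sum[where f = "\<lambda>j. \<Sum>i\<in>UNIV. (C $ i $ j)\<^sup>2"]) (auto intro: sum_nonneg)
      finally show ?thesis
        using lt e(1) abs_le_square_iff[of "C $ i $ j" e] by simp
    qed
    define x where "x = p - a\<^sup>2"
    define y where "y = r - b\<^sup>2"
    define z where "z = q - a * b"
    \<comment> \<open>These combinations of the diagonal entries eliminate \<open>k\<close>, so
      nothing has to be known about the third axial component.\<close>
    have "x = C $ 1 $ 1 - C $ 2 $ 2 - C $ 3 $ 3" "y = C $ 2 $ 2 - C $ 1 $ 1 - C $ 3 $ 3" "z = 2 * C $ 1 $ 2"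
      unfolding C x_def y_def z_def by (simp_all add: field_simps)
    then have xyz: "\<bar>x\<bar> \<le> 3 * e" "\<bar>y\<bar> \<le> 3 * e" "\<bar>z\<bar> \<le> 2 * e"
      using small[of 1 1] small[of 2 2] small[of 3 3] small[of 1 2] by linarith+
    have ab: "a\<^sup>2 \<le> p + 3" "b\<^sup>2 \<le> r + 3"
      using xyz e(2) unfolding x_def y_def by linarith+
    \<comment> \<open>Expansion of \<open>(a^2 + x) * (b^2 + y) - (a * b + z)^2\<close>, where the
      terms free of \<open>x\<close>, \<open>y\<close>, \<open>z\<close> cancel.\<close>
    have "d = a\<^sup>2 * y + b\<^sup>2 * x + x * y + 2 * (- (a * b)) * z - z\<^sup>2"
      by (simp add: d_def x_def y_def z_def power2_eq_square algebra_simps)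
    moreover have "a\<^sup>2 * y \<le> (p + 3) * (3 * e)"
    proof -
      have "a\<^sup>2 * y \<le> a\<^sup>2 * \<bar>y\<bar>"
        by (intro mult_left_mono) simp_all
      also have "\<dots> \<le> (p + 3) * (3 * e)"
        using assms(1) by (intro mult_mono ab xyz) simp_all
      finally show ?thesis .
    qed
    moreover have "b\<^sup>2 * x \<le> (r + 3) * (3 * e)"
    proof -
      have "b\<^sup>2 * x \<le> b\<^sup>2 * \<bar>x\<bar>"
        by (intro mult_left_mono) simp_all
      also have "\<dots> \<le> (r + 3) * (3 * e)"
        using assms(2) by (intro mult_mono ab xyz) simp_all
      finally show ?thesis .
    qed
    moreover have "x * y \<le> 9 * e"
    proof -
      have "x * y \<le> \<bar>x\<bar> * \<bar>y\<bar>"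
        by (metis abs_ge_self abs_mult)
      also have "\<dots> \<le> (3 * e) * (3 * 1)"
        using xyz e by (intro mult_mono) simp_all
      finally show ?thesis by simp
    qed
    moreover have "2 * (- (a * b)) * z \<le> (p + r + 6) * (2 * e)"
    proof -
      have "2 * (- (a * b)) * z \<le> (2 * \<bar>a * b\<bar>) * \<bar>z\<bar>"
        using abs_ge_self[of "2 * (- (a * b)) * z"] by (simp add: abs_mult)
      also have "2 * \<bar>a * b\<bar> \<le> a\<^sup>2 + b\<^sup>2"
        using zero_le_power2[of "\<bar>a\<bar> - \<bar>b\<bar>"] by (simp add: power2_diff abs_mult)
      then have "(2 * \<bar>a * b\<bar>) * \<bar>z\<bar> \<le> (p + r + 6) * (2 * e)"
        using ab xyz(3) assms by (intro mult_mono) simp_all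
      finally show ?thesis .
    qed
    moreover have "e * K = (p + 3) * (3 * e) + (r + 3) * (3 * e) + 9 * e + (p + r + 6) * (2 * e)"
      by (simp add: K_def algebra_simps)
    ultimately have "d \<le> e * K"
      using zero_le_power2[of z] by linarith
    then show False
      using e(3) d by simp
  qed
  then show ?thesis
    using e(1) by (intro exI[of _ "e\<^sup>2"]) auto
qed

text \<open>If \<open>a\<close> and \<open>b\<close> are not integrable, at least one of the two combinations is not integrable either,
  and then all three integrals are \<open>0\<close> by convention.\<close>

lemma integral_affine_combination:
  fixes a b :: "'a \<Rightarrow> real"
  assumes "integrable M a \<longleftrightarrow> integrable M b"
  shows "\<exists>t\<in>{1/2, 1/3}. (LINT x|M. (1 - t) * a x + t * b x) = (1 - t) * (LINT x|M. a x) + t * (LINT x|M. b x)"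
proof (cases "integrable M a")
  case True
  with assms show ?thesis
    by (intro bexI[of _ "1/2"]) auto
next
  case False
  with assms have zero: "(LINT x|M. a x) = 0" "(LINT x|M. b x) = 0"
    by (simp_all add: not_integrable_integral_eq)
  let ?c = "\<lambda>t x. (1 - t) * a x + t * b x"
  have "\<not> (integrable M (?c (1/2)) \<and> integrable M (?c (1/3)))"
  proof
    assume "integrable M (?c (1/2)) \<and> integrable M (?c (1/3))"
    then have "integrable M (\<lambda>x. 3 * ?c (1/3) x - 2 * ?c (1/2) x)"
      by (intro Bochner_Integration.integrable_diff integrable_mult_right) simp_all
    moreover have "3 * ?c (1/3) x - 2 * ?c (1/2) x = a x" for x
      by (simp add: field_simps)
    ultimately show False
      using False by simp
  qed
  then obtain t where "t \<in> {1/2, 1/3 :: real}" "\<not> integrable M (?c t)"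
    by blast
  then show ?thesis
    unfolding zero by (intro bexI[of _ t]) (simp_all add: not_integrable_integral_eq)
qed

section \<open>The energy of linear fields\<close>

text \<open>Completeness of Lebesgue measure transfers measurability from \<open>f\<close> to
  \<open>g\<close>. This matters because measurability of the forms is assumed for fixed matrices
  only, not along the chosen strain.\<close>

lemma integral_cong_AE_lebesgue_on:
  fixes f g :: "'a::euclidean_space \<Rightarrow> real"
  assumes [simp]: "S \<in> sets lebesgue" and f: "f \<in> borel_measurable (lebesgue_on S)"
    and ae: "AE x in lebesgue_on S. f x = g x"
  shows "integral\<^sup>L (lebesgue_on S) f = integral\<^sup>L (lebesgue_on S) g"
proof (rule integral_cong_AE[OF f _ ae])
  have "(\<lambda>x. indicator S x *\<^sub>R f x) \<in> borel_measurable lebesgue"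
    using f by (simp add: borel_measurable_restrict_space_iff)
  moreover have "AE x in lebesgue. indicator S x *\<^sub>R f x = indicator S x *\<^sub>R g x"
    using ae by (auto simp: AE_restrict_space_iff indicator_def elim!: eventually_mono)
  ultimately have "(\<lambda>x. indicator S x *\<^sub>R g x) \<in> borel_measurable lebesgue"
    by (rule borel_measurable_AE)
  then show "g \<in> borel_measurable (lebesgue_on S)"
    by (simp add: borel_measurable_restrict_space_iff)
qed

lemma energy_linear:
  fixes B :: "real^'n^'n"
  assumes "open \<Omega>" "bounded \<Omega>" "transpose B = B"
    and meas: "\<And>C. (\<lambda>x. V x C) \<in> borel_measurable (lebesgue_on \<Omega>)"
  shows "energy \<Omega> V f g ((*v) B) =
    (INF W\<in>skew_matrices. LINT x|lebesgue_on \<Omega>. V x (B - (1/2) *\<^sub>R (W ** W))) - load \<Omega> f g ((*v) B)"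
proof -
  have "(LINT x|lebesgue_on \<Omega>. V x (strain \<Omega> ((*v) B) x - (1/2) *\<^sub>R (W ** W))) =
    (LINT x|lebesgue_on \<Omega>. V x (B - (1/2) *\<^sub>R (W ** W)))" for W
    by (rule integral_cong_AE_lebesgue_on[symmetric, OF _ meas])
      (use assms(1) strain_linear[OF assms(1-3)] in \<open>auto elim!: eventually_mono\<close>)
  then show ?thesis
    by (simp add: energy_def)
qed

lemma integral_quadratic_bounds:
  fixes C :: "real^'n^'n"
  assumes "open \<Omega>" "bounded \<Omega>" "transpose C = C"
    and meas: "\<And>C. (\<lambda>x. V x C) \<in> borel_measurable (lebesgue_on \<Omega>)"
    and "0 < \<alpha>" "\<alpha> \<le> \<gamma>"
    and V: "AE x in lebesgue_on \<Omega>. \<forall>B\<in>sym_matrices.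
           \<alpha> * trace (transpose B ** B) \<le> V x B \<and> V x B \<le> \<gamma> * trace (transpose B ** B)"
  shows "\<alpha> * trace (transpose C ** C) * measure lebesgue \<Omega> \<le> (LINT x|lebesgue_on \<Omega>. V x C)"
    and "(LINT x|lebesgue_on \<Omega>. V x C) \<le> \<gamma> * trace (transpose C ** C) * measure lebesgue \<Omega>"
proof -
  have lm: "\<Omega> \<in> lmeasurable"
    using assms(1,2) by (rule lmeasurable_open[rotated])
  then interpret finite_measure "lebesgue_on \<Omega>"
    by (rule finite_measure_lebesgue_on)
  have tr: "0 \<le> trace (transpose C ** C)"
    unfolding trace_transpose_mult_self by (intro sum_nonneg) simp
  have b: "AE x in lebesgue_on \<Omega>. \<alpha> * trace (transpose C ** C) \<le> V x C \<and> V x C \<le> \<gamma> * trace (transpose C ** C)"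
    using V assms(3) by (auto simp: sym_matrices_def elim!: eventually_mono)
  \<comment> \<open>Without integrability the integral would be 0 by convention and the lower bound
    could fail.\<close>
  have int: "integrable (lebesgue_on \<Omega>) (\<lambda>x. V x C)"
  proof (rule integrable_const_bound[OF _ meas])
    show "AE x in lebesgue_on \<Omega>. norm (V x C) \<le> \<gamma> * trace (transpose C ** C)"
      using b
    proof (rule eventually_mono)
      fix x assume "\<alpha> * trace (transpose C ** C) \<le> V x C \<and> V x C \<le> \<gamma> * trace (transpose C ** C)"
      moreover have "0 \<le> \<alpha> * trace (transpose C ** C)"
        using tr assms(5) by simp
      ultimately show "norm (V x C) \<le> \<gamma> * trace (transpose C ** C)"
        by simp
    qed
  qed
  have const: "(LINT x|lebesgue_on \<Omega>. c) = c * measure lebesgue \<Omega>" for c :: real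
    using lm by (simp add: measure_restrict_space)
  have "(LINT x|lebesgue_on \<Omega>. \<alpha> * trace (transpose C ** C)) \<le> (LINT x|lebesgue_on \<Omega>. V x C)"
    using b by (intro integral_mono_AE int integrable_const) (auto elim!: eventually_mono)
  then show "\<alpha> * trace (transpose C ** C) * measure lebesgue \<Omega> \<le> (LINT x|lebesgue_on \<Omega>. V x C)"
    unfolding const .
  have "(LINT x|lebesgue_on \<Omega>. V x C) \<le> (LINT x|lebesgue_on \<Omega>. \<gamma> * trace (transpose C ** C))"
    using b by (intro integral_mono_AE int integrable_const) (auto elim!: eventually_mono)
  then show "(LINT x|lebesgue_on \<Omega>. V x C) \<le> \<gamma> * trace (transpose C ** C) * measure lebesgue \<Omega>"
    unfolding const .
qed

text \<open>The volume term is linear because \<open>g\<close> is integrable and linear fields are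
  bounded on \<Omega>. For the boundary term, linearity at the given coefficients is taken as the
  hypothesis \<open>bd\<close>.\<close>

lemma load_combination:
  fixes A B D :: "real^'n^'n"
  assumes "open \<Omega>" "bounded \<Omega>" and g: "square_integrable (lebesgue_on \<Omega>) g"
    and D: "\<And>x. D *v x = s *\<^sub>R (A *v x) + t *\<^sub>R (B *v x)"
    and bd: "(LINT x|boundary_measure \<Omega>. s * (f x \<bullet> (A *v x)) + t * (f x \<bullet> (B *v x))) =
      s * (LINT x|boundary_measure \<Omega>. f x \<bullet> (A *v x)) + t * (LINT x|boundary_measure \<Omega>. f x \<bullet> (B *v x))"
  shows "load \<Omega> f g ((*v) D) = s * load \<Omega> f g ((*v) A) + t * load \<Omega> f g ((*v) B)"
proof -
  have lm: "\<Omega> \<in> lmeasurable"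
    using assms(1,2) by (rule lmeasurable_open[rotated])
  then interpret finite_measure "lebesgue_on \<Omega>"
    by (rule finite_measure_lebesgue_on)
  have int: "integrable (lebesgue_on \<Omega>) (\<lambda>x. g x \<bullet> (C *v x))" for C :: "real^'n^'n"
  proof -
    have gi: "integrable (lebesgue_on \<Omega>) g"
      by (rule square_integrable_imp_integrable[OF g])
    have "bounded ((*v) C ` \<Omega>)"
      by (intro bounded_linear_image assms(2) matrix_vector_mul_bounded_linear)
    then obtain K where K: "\<And>x. x \<in> \<Omega> \<Longrightarrow> norm (C *v x) \<le> K"
      by (auto simp: bounded_iff)
    show ?thesis
    proof (rule Bochner_Integration.integrable_bound)
      show "integrable (lebesgue_on \<Omega>) (\<lambda>x. norm (g x) * K)"
        using gi by (intro integrable_mult_left integrable_norm)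
      have "(*v) C \<in> borel_measurable (lebesgue_on \<Omega>)"
        by (intro measurable_restrict_space1 measurable_completion)
          (simp add: borel_measurable_continuous_onI continuous_on_matrix_vector_mult)
      then show "(\<lambda>x. g x \<bullet> (C *v x)) \<in> borel_measurable (lebesgue_on \<Omega>)"
        using gi by (intro borel_measurable_inner) auto
      have "norm (g x \<bullet> (C *v x)) \<le> norm (norm (g x) * K)" if "x \<in> \<Omega>" for x
      proof -
        have "norm (g x \<bullet> (C *v x)) \<le> norm (g x) * norm (C *v x)"
          by (simp add: Cauchy_Schwarz_ineq2)
        also have "\<dots> \<le> norm (g x) * K"
          by (intro mult_left_mono K that) simp
        finally show ?thesis
          by simp
      qed
      then show "AE x in lebesgue_on \<Omega>. norm (g x \<bullet> (C *v x)) \<le> norm (norm (g x) * K)"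
        by (intro AE_I2) simp
    qed
  qed
  have "(LINT x|lebesgue_on \<Omega>. g x \<bullet> (D *v x)) =
      s * (LINT x|lebesgue_on \<Omega>. g x \<bullet> (A *v x)) + t * (LINT x|lebesgue_on \<Omega>. g x \<bullet> (B *v x))"
    by (simp add: D inner_add_right int)
  moreover have "(LINT x|boundary_measure \<Omega>. f x \<bullet> (D *v x)) =
      s * (LINT x|boundary_measure \<Omega>. f x \<bullet> (A *v x)) + t * (LINT x|boundary_measure \<Omega>. f x \<bullet> (B *v x))"
    using bd by (simp add: D inner_add_right)
  ultimately show ?thesis
    by (simp add: load_continuous[OF assms(1) continuous_on_matrix_vector_mult] algebra_simps)
qed

text \<open>The whole argument for one pair of axial vectors. The hypothesis \<open>iff\<close> is
  what makes the boundary term affine at some interior point of the segment.\<close>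

lemma not_convex_if_boundary_integrable_iff:
  fixes \<Omega> :: "(real^3) set"
  assumes "open \<Omega>" "bounded \<Omega>" "\<Omega> \<noteq> {}"
    and g: "square_integrable (lebesgue_on \<Omega>) g"
    and meas: "\<And>C. (\<lambda>x. V x C) \<in> borel_measurable (lebesgue_on \<Omega>)"
    and "0 < \<alpha>" "\<alpha> \<le> \<gamma>"
    and V: "AE x in lebesgue_on \<Omega>. \<forall>B\<in>sym_matrices.
           \<alpha> * trace (transpose B ** B) \<le> V x B \<and> V x B \<le> \<gamma> * trace (transpose B ** B)"
    and nonpar: "a * b' \<noteq> a' * b"
    and iff: "integrable (boundary_measure \<Omega>) (\<lambda>x. f x \<bullet> (axial_strain (a\<^sup>2) (a * b) (b\<^sup>2) *v x)) \<longleftrightarrow>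
      integrable (boundary_measure \<Omega>) (\<lambda>x. f x \<bullet> (axial_strain (a'\<^sup>2) (a' * b') (b'\<^sup>2) *v x))"
  shows "\<not> convex_functional (H1 \<Omega>) (energy \<Omega> V f g)"
proof
  assume convex: "convex_functional (H1 \<Omega>) (energy \<Omega> V f g)"
  define S where "S a b = axial_strain (a\<^sup>2) (a * b) (b\<^sup>2)" for a b
  define D where "D t = axial_strain ((1 - t) * a\<^sup>2 + t * a'\<^sup>2) ((1 - t) * (a * b) + t * (a' * b'))
    ((1 - t) * b\<^sup>2 + t * b'\<^sup>2)" for t
  define \<Phi> where "\<Phi> B = (INF W\<in>skew_matrices. LINT x|lebesgue_on \<Omega>. V x (B - (1/2) *\<^sub>R (W ** W)))" for B
  note bounds = integral_quadratic_bounds[OF assms(1,2) _ meas assms(6,7) V]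
  have \<Phi>: "energy \<Omega> V f g ((*v) B) = \<Phi> B - load \<Omega> f g ((*v) B)" if "transpose B = B" for B
    unfolding \<Phi>_def by (rule energy_linear[OF assms(1,2) that meas])
  have sym: "transpose (B - (1/2) *\<^sub>R (W ** W)) = B - (1/2) *\<^sub>R (W ** W)"
    if "transpose B = B" "W \<in> skew_matrices" for B W
    using that(1) skew_square_symmetric[OF that(2)] by (simp add: vec_eq_iff transpose_def)
  obtain t where t: "t = 1/2 \<or> t = 1/3"
    and bd: "(LINT x|boundary_measure \<Omega>. (1 - t) * (f x \<bullet> (S a b *v x)) + t * (f x \<bullet> (S a' b' *v x))) =
      (1 - t) * (LINT x|boundary_measure \<Omega>. f x \<bullet> (S a b *v x)) + t * (LINT x|boundary_measure \<Omega>. f x \<bullet> (S a' b' *v x))"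
    using integral_affine_combination[OF iff] unfolding S_def by blast
  have D: "D t *v x = (1 - t) *\<^sub>R (S a b *v x) + t *\<^sub>R (S a' b' *v x)" for x
    unfolding D_def S_def axial_strain_combination ..
  have load: "load \<Omega> f g ((*v) (D t)) = (1 - t) * load \<Omega> f g ((*v) (S a b)) + t * load \<Omega> f g ((*v) (S a' b'))"
    by (rule load_combination[OF assms(1,2) g D bd])
  have \<Phi>_S: "\<Phi> (S a b) \<le> 0" for a b
  proof -
    \<comment> \<open>A real infimum is known to be a lower bound only when the set is bounded
      below; coercivity supplies the bound 0.\<close>
    have "bdd_below ((\<lambda>W. LINT x|lebesgue_on \<Omega>. V x (S a b - (1/2) *\<^sub>R (W ** W))) ` skew_matrices)"
    proof (rule bdd_belowI2)
      fix W :: "real^3^3" assume W: "W \<in> skew_matrices"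
      let ?C = "S a b - (1/2) *\<^sub>R (W ** W)"
      have "0 \<le> \<alpha> * trace (transpose ?C ** ?C) * measure lebesgue \<Omega>"
        unfolding trace_transpose_mult_self using assms(6)
        by (intro mult_nonneg_nonneg sum_nonneg) simp_all
      also have "\<dots> \<le> (LINT x|lebesgue_on \<Omega>. V x ?C)"
        by (intro bounds(1) sym W) (simp add: S_def transpose_axial_strain)
      finally show "0 \<le> (LINT x|lebesgue_on \<Omega>. V x ?C)" .
    qed
    \<comment> \<open>For the skew matrix with axial vector \<open>(a, b, 0)\<close> the argument of
      the quadratic form is the zero matrix.\<close>
    then have "\<Phi> (S a b) \<le> (LINT x|lebesgue_on \<Omega>. V x (S a b - (1/2) *\<^sub>R (axial_skew a b ** axial_skew a b)))"
      unfolding \<Phi>_def by (rule cINF_lower[OF _ axial_skew_in])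
    also have "\<dots> = (LINT x|lebesgue_on \<Omega>. V x 0)"
      by (simp add: S_def half_axial_skew_square)
    also have "\<dots> \<le> \<gamma> * trace (transpose 0 ** (0 :: real^3^3)) * measure lebesgue \<Omega>"
      by (rule bounds(2)) (simp add: vec_eq_iff transpose_def)
    also have "\<dots> = 0"
      by (simp add: trace_def)
    finally show ?thesis .
  qed
  \<comment> \<open>The determinant of a weighted sum of two rank-one 2 by 2 matrices; it is
    positive exactly because the axial vectors are not parallel and \<open>t\<close> is
    interior.\<close>
  have det: "((1 - t) * a\<^sup>2 + t * a'\<^sup>2) * ((1 - t) * b\<^sup>2 + t * b'\<^sup>2) - ((1 - t) * (a * b) + t * (a' * b'))\<^sup>2 =
    t * (1 - t) * (a * b' - a' * b)\<^sup>2"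
    by (simp add: power2_eq_square algebra_simps)
  have "\<exists>c>0. \<forall>W\<in>skew_matrices. c \<le> trace (transpose (D t - (1/2) *\<^sub>R (W ** W)) ** (D t - (1/2) *\<^sub>R (W ** W)))"
    unfolding D_def
  proof (rule axial_strain_dist)
    show "0 < ((1 - t) * a\<^sup>2 + t * a'\<^sup>2) * ((1 - t) * b\<^sup>2 + t * b'\<^sup>2) - ((1 - t) * (a * b) + t * (a' * b'))\<^sup>2"
      unfolding det using t nonpar by (intro mult_pos_pos) auto
  qed (use t in \<open>auto intro!: add_nonneg_nonneg mult_nonneg_nonneg\<close>)
  then obtain c where c: "c > 0" "\<And>W. W \<in> skew_matrices \<Longrightarrow>
      c \<le> trace (transpose (D t - (1/2) *\<^sub>R (W ** W)) ** (D t - (1/2) *\<^sub>R (W ** W)))"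
    by blast
  have vol: "measure lebesgue \<Omega> > 0"
  proof -
    have "\<not> negligible \<Omega>"
      using assms(1,3) open_not_negligible by blast
    moreover have "\<Omega> \<in> lmeasurable"
      using assms(1,2) by (rule lmeasurable_open[rotated])
    ultimately show ?thesis
      by (simp add: negligible_iff_measure zero_less_measure_iff)
  qed
  \<comment> \<open>The bound does not depend on \<open>W\<close>, so it survives the infimum and no
    minimizer is required.\<close>
  have "\<alpha> * c * measure lebesgue \<Omega> \<le> \<Phi> (D t)"
    unfolding \<Phi>_def
  proof (rule cINF_greatest)
    show "skew_matrices \<noteq> ({} :: (real^3^3) set)"
      using axial_skew_in by blast
    fix W :: "real^3^3" assume W: "W \<in> skew_matrices"
    let ?C = "D t - (1/2) *\<^sub>R (W ** W)"
    have "\<alpha> * c * measure lebesgue \<Omega> \<le> \<alpha> * trace (transpose ?C ** ?C) * measure lebesgue \<Omega>"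
      using c(2)[OF W] assms(6) by (intro mult_right_mono mult_left_mono) simp_all
    also have "\<dots> \<le> (LINT x|lebesgue_on \<Omega>. V x ?C)"
      by (intro bounds(1) sym W) (simp add: D_def transpose_axial_strain)
    finally show "\<alpha> * c * measure lebesgue \<Omega> \<le> (LINT x|lebesgue_on \<Omega>. V x ?C)" .
  qed
  then have pos: "\<Phi> (D t) > 0"
    using assms(6) c(1) vol by (smt (verit) mult_pos_pos)
  have "energy \<Omega> V f g (\<lambda>x. (1 - t) *\<^sub>R (S a b *v x) + t *\<^sub>R (S a' b' *v x)) \<le>
      (1 - t) * energy \<Omega> V f g ((*v) (S a b)) + t * energy \<Omega> V f g ((*v) (S a' b'))"
    using convex[unfolded convex_functional_def, rule_format,
        OF linear_in_H1[OF assms(1,2)] linear_in_H1[OF assms(1,2)], of t "S a b" "S a' b'"] t by auto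
  then have "energy \<Omega> V f g ((*v) (D t)) \<le>
      (1 - t) * energy \<Omega> V f g ((*v) (S a b)) + t * energy \<Omega> V f g ((*v) (S a' b'))"
    by (simp only: D[symmetric])
  moreover have "transpose (D t) = D t" "transpose (S a b) = S a b" "transpose (S a' b') = S a' b'"
    by (simp_all add: D_def S_def transpose_axial_strain)
  \<comment> \<open>The load terms on both sides cancel.\<close>
  ultimately have "\<Phi> (D t) \<le> (1 - t) * \<Phi> (S a b) + t * \<Phi> (S a' b')"
    by (simp add: \<Phi> load algebra_simps)
  also have "\<dots> \<le> 0"
    using t \<Phi>_S[of a b] \<Phi>_S[of a' b'] by (intro add_nonpos_nonpos mult_nonneg_nonpos) auto
  finally show False
    using pos by simp
qed

theorem proposition2p2:
  fixes \<Omega> :: "(real^3) set"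
    and V\<^sub>0 :: "real^3 \<Rightarrow> real^3^3 \<Rightarrow> real"
    and f g :: "real^3 \<Rightarrow> real^3"
    and \<alpha> \<gamma> :: real
  assumes "open \<Omega>" and "connected \<Omega>" and "bounded \<Omega>" and "\<Omega> \<noteq> {}"
    and "lipschitz_boundary \<Omega>"
    and "square_integrable (boundary_measure \<Omega>) f"
    and "square_integrable (lebesgue_on \<Omega>) g"
    and "equilibrated \<Omega> f g"
    and "\<And>B. (\<lambda>x. V\<^sub>0 x B) \<in> borel_measurable (lebesgue_on \<Omega>)"
    and "AE x in lebesgue_on \<Omega>. quadratic_form (V\<^sub>0 x)"
    and "0 < \<alpha>" and "\<alpha> \<le> \<gamma>"
    and "AE x in lebesgue_on \<Omega>. \<forall>B\<in>sym_matrices.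
           \<alpha> * trace (transpose B ** B) \<le> V\<^sub>0 x B \<and> V\<^sub>0 x B \<le> \<gamma> * trace (transpose B ** B)"
  shows "\<not> convex_functional (H1 \<Omega>) (energy \<Omega> V\<^sub>0 f g)"
proof -
  note not_convex = not_convex_if_boundary_integrable_iff[OF assms(1,3,4,7,9,11,12,13), of _ _ _ _ f]
  let ?I = "\<lambda>a b. integrable (boundary_measure \<Omega>) (\<lambda>x. f x \<bullet> (axial_strain (a\<^sup>2) (a * b) (b\<^sup>2) *v x))"
  \<comment> \<open>Of three truth values two agree, and the vectors \<open>(1, 0)\<close>,
    \<open>(0, 1)\<close>, \<open>(1, 1)\<close> are pairwise non-parallel.\<close>
  consider "?I 1 0 \<longleftrightarrow> ?I 0 1" | "?I 1 0 \<longleftrightarrow> ?I 1 1" | "?I 0 1 \<longleftrightarrow> ?I 1 1"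
    by blast
  then show ?thesis
  proof cases
    case 1
    then show ?thesis
      \<comment> \<open>Rotation puts the integrability premise first, so the case assumption fixes
        both axial vectors; the goal left is that they are not parallel.\<close>
      by (rule not_convex[rotated]) simp
  next
    case 2
    then show ?thesis
      by (rule not_convex[rotated]) simp
  next
    case 3
    then show ?thesis
      by (rule not_convex[rotated]) simp
  qed
qed

end
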